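(* Let $\alpha,\beta$ be positive real numbers with $\alpha\beta=\pi^2$ and let $k,N$ be positive integers. Then $$ \begin{aligned} \beta^{k(N+1)-1}\sum_{n=1}^{\infty}\frac{(-1)^{n-1}F_\alpha(n,1;k)}{n^{2k(N+1)-1}} &=(-1)^N\alpha^{k(N+1)-1}\sum_{n=1}^{\infty}\frac{(-1)^{n-1}F_\beta(n,1;k)}{n^{2k(N+1)-1}}\\ &\quad+\sum_{p=0}^{N+1}(-1)^{p+1}\zeta_E(2kp,1)\,\zeta_E(2k(N-p+1),1)\,\alpha^{kp-1}\beta^{k(N+1-p)-1}. \end{aligned} $$
   Context: The alternating Hurwitz zeta function is $\zeta_E(z,x)=\sum_{n=0}^{\infty}\frac{(-1)^n}{(n+x)^z}$ for $\operatorname{Re}(z)>0$, continued analytically in $z$ to all of $\mathbb{C}$ (in particular to $z=0$). For $x>0$ and a positive integer $k$, the even-order alternating Hurwitz kernel is $$F(x,a;k)=\frac{1}{2\pi i}\int_{(c)}\frac{\zeta_E(1-s,a)}{2k\cos\left(\frac{\pi(s+k-1)}{2k}\right)}x^{-s}\,ds=-\frac{1}{2\pi x}+\frac{x^{2k-1}}{\pi}\sum_{n=0}^{\infty}\frac{(-1)^n}{(n+a)^{2k}+x^{2k}},$$ where $(c)$ is the vertical line $\operatorname{Re}(s)=c$ with $1<c<2$. For $\alpha>0$, $F_\alpha(x,a;k)=F\!\left(\frac{\alpha x}{\pi},a;k\right)$, and similarly $F_\beta$. *)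

theory Defs
  imports "HOL-Complex_Analysis.Complex_Analysis"
begin

text \<open>
  For \<open>x > 0\<close> there is exactly one entire function agreeing with the alternating series on
  the half-plane of its (in general only conditional) convergence; the value for \<open>x \<le> 0\<close>
  is meaningless.
\<close>

definition alt_hurwitz_zeta :: "complex \<Rightarrow> real \<Rightarrow> complex" where
  "alt_hurwitz_zeta z x =
     (THE f. f holomorphic_on UNIV \<and>
        (\<forall>w. Re w > 0 \<longrightarrow>
           (\<lambda>n. (-1) ^ n / complex_of_real (real n + x) powr w) sums f w)) z"

text \<open>The factor \<open>\<i>\<close> is the derivative of the upward parametrization \<open>t \<mapsto> c + \<i> t\<close>.\<close>

definition vertical_line_integral :: "real \<Rightarrow> (complex \<Rightarrow> complex) \<Rightarrow> complex" where
  "vertical_line_integral c g = \<i> * (LBINT t. g (Complex c t))"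

text \<open>
  The abscissa \<open>c\<close> of the line of integration is an explicit argument. The intended range is
  \<open>1 < c < 2\<close>, where no pole of the integrand lies and the value does not depend on \<open>c\<close>.
\<close>

definition alt_hurwitz_kernel :: "real \<Rightarrow> real \<Rightarrow> real \<Rightarrow> nat \<Rightarrow> complex" where
  "alt_hurwitz_kernel c x a k =
     1 / (2 * complex_of_real pi * \<i>) *
     vertical_line_integral c (\<lambda>s.
       alt_hurwitz_zeta (1 - s) a
         / (2 * of_nat k * cos (complex_of_real pi * (s + of_nat k - 1) / (2 * of_nat k)))
         * complex_of_real x powr (- s))"

definition scaled_alt_hurwitz_kernel ::
    "real \<Rightarrow> real \<Rightarrow> real \<Rightarrow> real \<Rightarrow> nat \<Rightarrow> complex" where
  "scaled_alt_hurwitz_kernel c \<alpha> x a k = alt_hurwitz_kernel c (\<alpha> * x / pi) a k"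

end

theory Submission
  imports Defs "HOL-Probability.Sinc_Integral"
begin

text \<open>
  Euler's transformation of the alternating series converges on ever larger half-planes. It yields the
  entire continuation and, with two steps, an absolutely convergent series for it on the line of
  integration, so the kernel can be integrated term by term without moving the line. Each term is a
  Mellin inversion \<open>(1 / 2 \<pi> \<i>) \<integral> X powr (- s) / sin (\<pi> s) ds = (1 / \<pi>) / (1 + X)\<close>, obtained from
  one rectangle, and undoing the two Euler steps gives the series form of the kernel.

  Put \<open>U = \<alpha> ^ k * n ^ (2 * k)\<close> and \<open>V = \<beta> ^ k * m ^ (2 * k)\<close>. Since \<open>\<alpha> * \<beta> = pi ^ 2\<close>, the two
  sides become absolutely convergent double series in \<open>U powi (- N) / (U + V)\<close> and
  \<open>V powi (- N) / (U + V)\<close>. Their signed difference is a finite geometric sum of products of powers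
  of \<open>U\<close> and \<open>V\<close>, hence of products of zeta values. The terms \<open>p = 0\<close> and \<open>p = N + 1\<close> come from the
  term \<open>- 1 / (2 \<pi> x)\<close> of the kernel.
\<close>

section \<open>Continuation of the alternating zeta function by Euler's transformation\<close>

text \<open>Twice a partial sum of the alternating series is the partial sum of its alternating
  differences, up to \<open>u 0\<close> and a boundary term that tends to 0. This is one Euler step.
  Left to right it accelerates the zeta series; right to left it undoes the acceleration in the
  kernel.\<close>

lemma sums_alternating_telescope:
  fixes u :: "nat \<Rightarrow> 'a::real_normed_field"
  assumes "u \<longlonglongrightarrow> 0"
  shows "(\<lambda>n. (-1) ^ n * (u n - u (Suc n))) sums S \<longleftrightarrow> (\<lambda>n. (-1) ^ n * u n) sums ((u 0 + S) / 2)"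
proof -
  have partial: "(\<Sum>i<n. (-1) ^ i * (u i - u (Suc i))) = 2 * (\<Sum>i<n. (-1) ^ i * u i) - u 0 + (-1) ^ n * u n" for n
    by (induction n) (simp_all add: algebra_simps)
  have "(\<lambda>n. norm ((-1) ^ n * u n)) \<longlonglongrightarrow> 0"
    using tendsto_norm[OF assms] by (simp add: norm_mult norm_power)
  then have lim: "(\<lambda>n. (-1) ^ n * u n) \<longlonglongrightarrow> 0"
    by (rule tendsto_norm_zero_cancel)
  show ?thesis
  proof
    assume "(\<lambda>n. (-1) ^ n * (u n - u (Suc n))) sums S"
    then have "(\<lambda>n. (u 0 + (\<Sum>i<n. (-1) ^ i * (u i - u (Suc i))) - (-1) ^ n * u n) / 2) \<longlonglongrightarrow> (u 0 + S - 0) / 2"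
      unfolding sums_def using lim by (intro tendsto_intros) auto
    then show "(\<lambda>n. (-1) ^ n * u n) sums ((u 0 + S) / 2)"
      by (simp add: sums_def partial)
  next
    assume "(\<lambda>n. (-1) ^ n * u n) sums ((u 0 + S) / 2)"
    then have "(\<lambda>n. 2 * (\<Sum>i<n. (-1) ^ i * u i) - u 0 + (-1) ^ n * u n) \<longlonglongrightarrow> 2 * ((u 0 + S) / 2) - u 0 + 0"
      unfolding sums_def using lim by (intro tendsto_intros) auto
    then show "(\<lambda>n. (-1) ^ n * (u n - u (Suc n))) sums S"
      by (simp add: sums_def partial add_divide_distrib)
  qed
qed

text \<open>This is \<open>(-1) ^ m\<close> times the \<open>m\<close>-th forward difference of
  \<open>w powr (- z)\<close> in \<open>w\<close>. The base \<open>w\<close> is complex so that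
  complex differentiation applies to it.\<close>

primrec powr_diff :: "nat \<Rightarrow> complex \<Rightarrow> complex \<Rightarrow> complex" where
  "powr_diff 0 z w = w powr (- z)"
| "powr_diff (Suc m) z w = powr_diff m z w - powr_diff m z (w + 1)"

lemma powr_diff_at_0: "w \<notin> \<real>\<^sub>\<le>\<^sub>0 \<Longrightarrow> powr_diff m 0 w = (if m = 0 then 1 else 0)"
proof (induction m arbitrary: w)
  case 0
  then show ?case by (auto simp: complex_nonpos_Reals_iff)
next
  case (Suc m)
  then have "w + 1 \<notin> \<real>\<^sub>\<le>\<^sub>0" by (auto simp: complex_nonpos_Reals_iff)
  with Suc show ?case by simp
qed

lemma has_field_derivative_powr_diff:
  "w \<notin> \<real>\<^sub>\<le>\<^sub>0 \<Longrightarrow> (powr_diff m z has_field_derivative - z * powr_diff m (z + 1) w) (at w)"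
proof (induction m arbitrary: w)
  case 0
  then show ?case
    using has_field_derivative_powr[of w "- z"] by (simp add: minus_diff_commute)
next
  case (Suc m)
  have "w + 1 \<notin> \<real>\<^sub>\<le>\<^sub>0" using Suc.prems by (auto simp: complex_nonpos_Reals_iff)
  then have "(powr_diff m z has_field_derivative - z * powr_diff m (z + 1) (w + 1)) (at (w + 1))"
    by (rule Suc.IH)
  then have "((\<lambda>w. powr_diff m z (w + 1)) has_field_derivative - z * powr_diff m (z + 1) (w + 1)) (at w)"
    by (simp add: DERIV_shift)
  from DERIV_diff[OF Suc.IH[OF Suc.prems] this] show ?case
    by (simp add: algebra_simps)
qed

text \<open>Each difference gains one power of \<open>x\<close>: a unit step is bounded by the
  derivative on the segment, which is \<open>- z\<close> times a difference of order
  \<open>m\<close> at \<open>z + 1\<close>, and \<open>z * pochhammer (z + 1) m\<close> is the next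
  Pochhammer symbol. The condition on \<open>Re z + real m\<close> keeps the bounding power from
  increasing along the segment, so its left end decides.\<close>

lemma norm_powr_diff_le:
  assumes "x > 0" and "Re z + real m \<ge> 0"
  shows "norm (powr_diff m z (of_real x)) \<le> norm (pochhammer z m) * x powr (- Re z - real m)"
  using assms
proof (induction m arbitrary: z x)
  case 0
  then show ?case by (simp add: norm_powr_real_powr)
next
  case (Suc m)
  define S where "S = closed_segment (complex_of_real x) (of_real (x + 1))"
  have bound: "norm (- z * powr_diff m (z + 1) w) \<le> norm (pochhammer z (Suc m)) * x powr (- Re z - real (Suc m))"
    and pos: "w \<notin> \<real>\<^sub>\<le>\<^sub>0" if wS: "w \<in> S" for w
  proof -
    obtain y where "y \<in> closed_segment x (x + 1)" and w: "w = of_real y"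
      using wS unfolding S_def closed_segment_of_real by blast
    then have "x \<le> y" by (simp add: closed_segment_eq_real_ivl)
    note y = w this
    then show "w \<notin> \<real>\<^sub>\<le>\<^sub>0" using Suc.prems by (simp add: complex_nonpos_Reals_iff)
    have exponent: "- Re z - real (Suc m) = - Re (z + 1) - real m" by simp
    have "norm (powr_diff m (z + 1) w) \<le> norm (pochhammer (z + 1) m) * y powr (- Re (z + 1) - real m)"
      unfolding w by (rule Suc.IH) (use y Suc.prems in auto)
    also have "\<dots> \<le> norm (pochhammer (z + 1) m) * x powr (- Re (z + 1) - real m)"
      by (intro mult_left_mono powr_mono2') (use y Suc.prems in auto)
    finally have "norm z * norm (powr_diff m (z + 1) w) \<le> norm z * (norm (pochhammer (z + 1) m) * x powr (- Re (z + 1) - real m))"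
      by (intro mult_left_mono) auto
    then show "norm (- z * powr_diff m (z + 1) w) \<le> norm (pochhammer z (Suc m)) * x powr (- Re z - real (Suc m))"
      unfolding exponent by (simp add: pochhammer_rec norm_mult mult.assoc)
  qed
  have "norm (powr_diff m z (of_real x) - powr_diff m z (of_real (x + 1)))
      \<le> norm (pochhammer z (Suc m)) * x powr (- Re z - real (Suc m)) * norm (complex_of_real x - of_real (x + 1))"
    by (rule field_differentiable_bound[OF _ has_field_derivative_at_within[OF has_field_derivative_powr_diff[OF pos]] bound])
       (auto simp: S_def)
  then show ?case by simp
qed

lemma powr_diff_shift_tendsto_0:
  assumes "a > 0" and "Re z + real m > 0"
  shows "(\<lambda>n. powr_diff m z (of_real (real n + a))) \<longlonglongrightarrow> 0"
proof (rule Lim_null_comparison)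
  show "\<forall>\<^sub>F n in sequentially. norm (powr_diff m z (of_real (real n + a)))
          \<le> norm (pochhammer z m) * (real n + a) powr (- Re z - real m)"
    using assms by (intro always_eventually allI norm_powr_diff_le) auto
  have "(\<lambda>n. (real n + a) powr - (Re z + real m)) \<longlonglongrightarrow> 0"
    using assms by (intro tendsto_neg_powr) (simp_all add: add.commute[of _ a]
        filterlim_tendsto_add_at_top[OF tendsto_const filterlim_real_sequentially])
  from tendsto_mult_right_zero[OF this]
  show "(\<lambda>n. norm (pochhammer z m) * (real n + a) powr (- Re z - real m)) \<longlonglongrightarrow> 0"
    by (simp add: algebra_simps)
qed

lemma summable_shift_powr:
  assumes "p < - 1"
  shows "summable (\<lambda>n. (real n + a) powr p)"
proof (rule summable_comparison_test')
  show "summable (\<lambda>n. (2 powr (- p)) * real n powr p)"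
    using assms by (intro summable_mult) (simp add: summable_real_powr_iff)
next
  fix n assume n: "n \<ge> nat \<lceil>2 * \<bar>a\<bar>\<rceil> + 1"
  then have *: "real n / 2 \<le> real n + a" "real n > 0" by linarith+
  then have "(real n + a) powr p \<le> (real n / 2) powr p"
    using assms by (intro powr_mono2') auto
  also have "\<dots> = 2 powr (- p) * real n powr p"
    using * by (simp add: powr_divide powr_minus field_simps)
  finally show "norm ((real n + a) powr p) \<le> 2 powr (- p) * real n powr p" by simp
qed

lemma summable_powr_diff:
  assumes "a > 0" and "Re z + real m > 1"
  shows "summable (\<lambda>n. (-1) ^ n * powr_diff m z (of_real (real n + a)))"
proof (rule summable_comparison_test')
  show "summable (\<lambda>n. norm (pochhammer z m) * (real n + a) powr (- Re z - real m))"
    using assms by (intro summable_mult summable_shift_powr) auto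
  show "norm ((-1) ^ n * powr_diff m z (of_real (real n + a))) \<le> norm (pochhammer z m) * (real n + a) powr (- Re z - real m)" for n
    using norm_powr_diff_le[of "real n + a" z m] assms by (simp add: norm_mult norm_power)
qed

text \<open>The alternating series after \<open>m\<close> steps of Euler's transformation; it converges absolutely for
  \<open>Re z > 1 - m\<close>.\<close>

definition euler_zeta :: "nat \<Rightarrow> real \<Rightarrow> complex \<Rightarrow> complex" where
  "euler_zeta m a z = (\<Sum>j<m. powr_diff j z (of_real a) / 2 ^ (j + 1))
     + (\<Sum>n. (-1) ^ n * powr_diff m z (of_real (real n + a))) / 2 ^ m"

text \<open>The series of order \<open>Suc m\<close> converges absolutely already for
  \<open>Re z + real m > 0\<close>, and the Euler step carries convergence back to order
  \<open>m\<close>, where it is in general only conditional.\<close>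

lemma sums_powr_diff_Suc:
  assumes "a > 0" and "Re z + real m > 0"
  shows "(\<lambda>n. (-1) ^ n * powr_diff m z (of_real (real n + a))) sums
     ((powr_diff m z (of_real a) + (\<Sum>n. (-1) ^ n * powr_diff (Suc m) z (of_real (real n + a)))) / 2)"
proof -
  have "powr_diff (Suc m) z (of_real (real n + a)) =
      powr_diff m z (of_real (real n + a)) - powr_diff m z (of_real (real (Suc n) + a))" for n
    by (simp add: add_ac)
  moreover have "(\<lambda>n. (-1) ^ n * powr_diff (Suc m) z (of_real (real n + a))) sums
     (\<Sum>n. (-1) ^ n * powr_diff (Suc m) z (of_real (real n + a)))"
    using assms by (intro summable_sums summable_powr_diff) auto
  ultimately have "(\<lambda>n. (-1) ^ n * (powr_diff m z (of_real (real n + a)) - powr_diff m z (of_real (real (Suc n) + a)))) sums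
     (\<Sum>n. (-1) ^ n * powr_diff (Suc m) z (of_real (real n + a)))"
    by (simp only:)
  from iffD1[OF sums_alternating_telescope[OF powr_diff_shift_tendsto_0[OF assms]] this]
  show ?thesis by simp
qed

lemma euler_zeta_Suc:
  assumes "a > 0" and "Re z + real m > 0"
  shows "euler_zeta (Suc m) a z = euler_zeta m a z"
  by (simp add: euler_zeta_def sums_unique[OF sums_powr_diff_Suc[OF assms], symmetric] add_divide_distrib
           del: powr_diff.simps of_real_add)

lemma euler_zeta_eq:
  assumes "a > 0" and "Re z + real m > 0" and "m \<le> m'"
  shows "euler_zeta m' a z = euler_zeta m a z"
  using \<open>m \<le> m'\<close>
proof (induction rule: dec_induct)
  case (step n)
  then show ?case using euler_zeta_Suc[of a z n] assms by simp
qed simp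

lemma holomorphic_powr_diff:
  assumes "x > 0"
  shows "(\<lambda>z. powr_diff m z (of_real x)) holomorphic_on S"
  using assms
proof (induction m arbitrary: x)
  case 0
  then show ?case by (auto intro!: holomorphic_intros simp: powr_def)
next
  case (Suc m)
  then show ?case using Suc.IH[of "x + 1"] by (auto intro!: holomorphic_intros)
qed

lemma holomorphic_euler_zeta:
  assumes "a > 0"
  shows "euler_zeta m a holomorphic_on {z. Re z + real m > 1}"
proof -
  define S where "S = {z. Re z + real m > 1}"
  have S: "open S"
    unfolding S_def using open_halfspace_Re_gt[of "1 - real m"] by (simp add: algebra_simps)
  obtain g where g: "\<forall>z\<in>S. (\<lambda>n. (-1) ^ n * powr_diff m z (of_real (real n + a))) sums g z \<and> g field_differentiable at z"
  proof (rule series_differentiable_comparison_complex[OF S])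
    fix n :: nat and z assume "z \<in> S"
    show "(\<lambda>z. (-1) ^ n * powr_diff m z (of_real (real n + a))) field_differentiable at z"
      using holomorphic_powr_diff[of "real n + a" m UNIV] assms
      by (intro field_differentiable_mult field_differentiable_const)
         (auto simp: holomorphic_on_def)
  next
    fix z assume "z \<in> S"
    \<comment> \<open>Half the excess over the boundary of absolute convergence: on the ball of
      radius \<open>d\<close> the exponent stays at most \<open>- 1 - d\<close>, which gives one
      summable majorant for the whole ball.\<close>
    define d where "d = (Re z + real m - 1) / 2"
    have d: "d > 0" using \<open>z \<in> S\<close> by (simp add: d_def S_def)
    have "continuous_on (cball z d) (\<lambda>w. pochhammer w m)"
      by (intro holomorphic_on_imp_continuous_on holomorphic_intros)
    then have "bounded ((\<lambda>w. pochhammer w m) ` cball z d)"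
      by (intro compact_imp_bounded compact_continuous_image compact_cball)
    then obtain B where B: "\<And>w. w \<in> cball z d \<Longrightarrow> norm (pochhammer w m) \<le> B"
      unfolding bounded_iff by blast
    have B0: "B \<ge> 0" using B[of z] d order_trans[OF norm_ge_zero] by force
    define h where "h = (\<lambda>n. complex_of_real (B * (real n + a) powr (- 1 - d)))"
    have "summable h" unfolding h_def
      by (intro summable_of_real summable_mult summable_shift_powr) (use d in auto)
    moreover have "range h \<subseteq> \<real>\<^sub>\<ge>\<^sub>0" using B0 by (auto simp: h_def)
    moreover have "\<forall>\<^sub>F n in sequentially. \<forall>w\<in>ball z d \<inter> S.
        norm ((-1) ^ n * powr_diff m w (of_real (real n + a))) \<le> norm (h n)"
      using eventually_ge_at_top[of 1]
    proof eventually_elim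
      case (elim n)
      show ?case
      proof
        fix w assume w: "w \<in> ball z d \<inter> S"
        then have "norm (z - w) < d" by (auto simp: dist_norm)
        then have "Re z - Re w < d" using abs_Re_le_cmod[of "z - w"] by auto
        then have Re_w: "Re w + real m \<ge> 1 + d" by (simp add: d_def field_simps)
        have "norm (powr_diff m w (of_real (real n + a))) \<le> norm (pochhammer w m) * (real n + a) powr (- Re w - real m)"
          using assms Re_w d by (intro norm_powr_diff_le) auto
        also have "\<dots> \<le> B * (real n + a) powr (- 1 - d)"
          using w Re_w d elim assms by (intro mult_mono B powr_mono B0) auto
        finally show "norm ((-1) ^ n * powr_diff m w (of_real (real n + a))) \<le> norm (h n)"
          using B0 by (simp add: norm_mult norm_power h_def)
      qed
    qed
    ultimately show "\<exists>d (h :: nat \<Rightarrow> complex). 0 < d \<and> summable h \<and> range h \<subseteq> \<real>\<^sub>\<ge>\<^sub>0 \<and> (\<forall>\<^sub>F n in sequentially. \<forall>w\<in>ball z d \<inter> S.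
        norm ((-1) ^ n * powr_diff m w (of_real (real n + a))) \<le> norm (h n))"
      using d by (intro exI[of _ d] exI[of _ h] conjI)
  qed auto
  have "g holomorphic_on S"
    using g by (auto simp: holomorphic_on_def intro: field_differentiable_at_within)
  then have "(\<lambda>z. (\<Sum>j<m. powr_diff j z (of_real a) / 2 ^ (j + 1)) + g z / 2 ^ m) holomorphic_on S"
    using assms by (intro holomorphic_intros holomorphic_powr_diff) auto
  then show ?thesis
    unfolding S_def[symmetric]
    by (rule holomorphic_transform) (use g in \<open>auto simp: euler_zeta_def sums_iff\<close>)
qed

text \<open>Different numbers of Euler steps agree where both apply, so the local formulas glue to
  one entire function. The identity theorem, applied from the right half-plane, makes it the only
  one, so the definite description denotes it.\<close>

lemma alt_hurwitz_zeta_eq_euler_zeta: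
  assumes "a > 0" and "Re z + real m > 1"
  shows "alt_hurwitz_zeta z a = euler_zeta m a z"
proof -
  \<comment> \<open>The number of steps depends on the point: it makes \<open>Re z + real m\<close>
    at least 2, safely above the threshold 1.\<close>
  define f where "f = (\<lambda>z. euler_zeta (nat \<lceil>2 - Re z\<rceil>) a z)"
  have f_eq: "f z = euler_zeta m a z" if "Re z + real m > 1" for z m
  proof -
    have 1: "Re z + real (nat \<lceil>2 - Re z\<rceil>) > 1" by linarith
    show ?thesis
      unfolding f_def
      using euler_zeta_eq[of a z "nat \<lceil>2 - Re z\<rceil>" "max m (nat \<lceil>2 - Re z\<rceil>)"]
        euler_zeta_eq[of a z m "max m (nat \<lceil>2 - Re z\<rceil>)"] 1 that assms(1) by simp
  qed
  have hol: "f holomorphic_on UNIV"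
  proof -
    have "f field_differentiable at z" for z
    proof -
      define m where "m = nat \<lceil>2 - Re z\<rceil>"
      have z: "Re z + real m > 1" unfolding m_def by linarith
      have op: "open {z. Re z + real m > 1}"
        using open_halfspace_Re_gt[of "1 - real m"] by (simp add: algebra_simps)
      have "f holomorphic_on {z. Re z + real m > 1}"
        by (rule holomorphic_transform[OF holomorphic_euler_zeta[OF assms(1)]]) (simp add: f_eq)
      with op z show ?thesis using holomorphic_on_imp_differentiable_at by blast
    qed
    then show ?thesis by (simp add: holomorphic_on_def)
  qed
  have sums: "(\<lambda>n. (-1) ^ n / complex_of_real (real n + a) powr w) sums f w" if "Re w > 0" for w
  proof -
    have "(\<lambda>n. (-1) ^ n * powr_diff 0 w (of_real (real n + a))) sums euler_zeta 1 a w"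
      using sums_powr_diff_Suc[of a w 0] assms that
      by (simp add: euler_zeta_def add_divide_distrib del: of_real_add)
    moreover have "f w = euler_zeta 1 a w" using that by (intro f_eq) auto
    ultimately show ?thesis by (simp add: powr_minus divide_inverse)
  qed
  have "(THE f. f holomorphic_on UNIV \<and>
        (\<forall>w. Re w > 0 \<longrightarrow> (\<lambda>n. (-1) ^ n / complex_of_real (real n + a) powr w) sums f w)) = f"
  proof (rule the_equality)
    fix g assume g: "g holomorphic_on UNIV \<and>
        (\<forall>w. Re w > 0 \<longrightarrow> (\<lambda>n. (-1) ^ n / complex_of_real (real n + a) powr w) sums g w)"
    have "g w = f w" for w
    proof (rule analytic_continuation_open[of "{w. Re w > 0}" UNIV g f])
      show "g w = f w" if "w \<in> {w. Re w > 0}" for w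
        using that g sums sums_unique2 by blast
      show "{w. Re w > 0} \<noteq> {}" by (auto intro: exI[of _ 1])
    qed (use g hol in \<open>auto simp: open_halfspace_Re_gt\<close>)
    then show "g = f" ..
  qed (use hol sums in blast)
  then show ?thesis
    unfolding alt_hurwitz_zeta_def using f_eq assms by simp
qed

text \<open>At \<open>z = 0\<close> the powers are constant, all differences of positive order
  vanish, and only the first Euler term \<open>1 / 2\<close> is left. Two steps are taken because
  the formula needs \<open>0 + m > 1\<close>.\<close>

lemma alt_hurwitz_zeta_0: "a > 0 \<Longrightarrow> alt_hurwitz_zeta 0 a = 1 / 2"
  by (subst alt_hurwitz_zeta_eq_euler_zeta[where m = 2])
     (simp_all add: euler_zeta_def powr_diff_at_0 complex_nonpos_Reals_iff numeral_2_eq_2 del: powr_diff.simps of_real_add)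

lemma alt_hurwitz_zeta_nat_sums:
  assumes "a > 0" and "q > 0"
  shows "(\<lambda>n. (-1) ^ n / complex_of_real (real n + a) ^ q) sums alt_hurwitz_zeta (of_nat q) a"
proof -
  have "(\<lambda>n. (-1) ^ n * powr_diff 0 (of_nat q) (of_real (real n + a))) sums euler_zeta 1 a (of_nat q)"
    using sums_powr_diff_Suc[of a "of_nat q" 0] assms
    by (simp add: euler_zeta_def add_divide_distrib del: of_real_add)
  moreover have "alt_hurwitz_zeta (of_nat q) a = euler_zeta 1 a (of_nat q)"
    using assms by (intro alt_hurwitz_zeta_eq_euler_zeta) auto
  moreover have "powr_diff 0 (of_nat q) (of_real (real n + a)) = 1 / complex_of_real (real n + a) ^ q" for n
    using assms by (simp add: powr_minus powr_nat' divide_inverse add_nonneg_pos del: of_real_add)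
  ultimately show ?thesis by simp
qed

section \<open>Evaluation of the kernel\<close>

text \<open>The hyperbolic cosine dominates a fourth power of \<open>1 + |t|\<close>, so the
  quotient is at most a multiple of \<open>1 / (1 + t^2)\<close>. The quadratic numerator is the
  price of two Euler steps, whose estimate contains \<open>pochhammer z 2\<close>.\<close>

lemma integrable_quadratic_over_cosh:
  fixes f :: "real \<Rightarrow> complex"
  assumes "\<delta> > 0" and "continuous_on UNIV f"
    and bound: "\<And>t. norm (f t) \<le> B * (1 + t\<^sup>2) / cosh (\<delta> * t)"
  shows "integrable lborel f"
proof (rule Bochner_Integration.integrable_bound)
  \<comment> \<open>Chosen so that \<open>m * (1 + |t|) \<le> 1 + \<delta> * |t| / 4\<close>; the
    fourth power of \<open>exp (\<delta> * |t| / 4)\<close> is then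
    \<open>exp (\<delta> * |t|)\<close>.\<close>
  define m where "m = min 1 (\<delta> / 4)"
  have m: "0 < m" "m \<le> 1" "m \<le> \<delta> / 4" using assms by (auto simp: m_def)
  have "integrable lborel (\<lambda>t::real. inverse (1 + t\<^sup>2))"
    using integrable_inverse_1_plus_square by (simp add: set_integrable_def)
  then show "integrable lborel (\<lambda>t::real. \<bar>B\<bar> * (2 / m ^ 4) * inverse (1 + t\<^sup>2))"
    by (intro integrable_mult_right)
  show "f \<in> borel_measurable lborel"
    using assms(2) by (simp add: borel_measurable_continuous_onI)
  show "AE t in lborel. norm (f t) \<le> norm (\<bar>B\<bar> * (2 / m ^ 4) * inverse (1 + t\<^sup>2))"
  proof (intro AE_I2)
    fix t :: real
    have "(m * (1 + \<bar>t\<bar>)) ^ 4 \<le> (1 + \<delta> * \<bar>t\<bar> / 4) ^ 4"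
      using m mult_right_mono[OF m(3), of "\<bar>t\<bar>"] by (intro power_mono) (auto simp: algebra_simps)
    also have "\<dots> \<le> exp (\<delta> * \<bar>t\<bar> / 4) ^ 4"
      using assms by (intro power_mono exp_ge_add_one_self) auto
    also have "\<dots> = exp (\<delta> * \<bar>t\<bar>)"
      by (simp flip: exp_of_nat_mult)
    also have "\<dots> \<le> 2 * cosh (\<delta> * \<bar>t\<bar>)"
      by (simp add: cosh_def)
    also have "cosh (\<delta> * \<bar>t\<bar>) = cosh (\<delta> * t)"
      by (cases "t \<ge> 0") auto
    finally have 1: "m ^ 4 * (1 + \<bar>t\<bar>) ^ 4 \<le> 2 * cosh (\<delta> * t)"
      by (simp add: power_mult_distrib)
    have "1 + t\<^sup>2 \<le> (1 + \<bar>t\<bar>)\<^sup>2"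
      by (simp add: power2_eq_square algebra_simps)
    then have "(1 + t\<^sup>2)\<^sup>2 \<le> ((1 + \<bar>t\<bar>)\<^sup>2)\<^sup>2"
      by (intro power_mono) auto
    also have "\<dots> = (1 + \<bar>t\<bar>) ^ 4" by simp
    finally have "m ^ 4 * (1 + t\<^sup>2)\<^sup>2 \<le> 2 * cosh (\<delta> * t)"
      using 1 m by (meson mult_left_mono order_trans zero_le_power less_imp_le)
    moreover have "X / C \<le> (2 / M) * inverse X" if "M * X\<^sup>2 \<le> 2 * C" "M > 0" "X > 0" "C > 0" for M X C :: real
      using that by (simp add: field_simps power2_eq_square)
    ultimately have "(1 + t\<^sup>2) / cosh (\<delta> * t) \<le> (2 / m ^ 4) * inverse (1 + t\<^sup>2)"
      using m cosh_real_pos[of "\<delta> * t"] by (simp add: add_pos_nonneg)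
    then have "\<bar>B\<bar> * ((1 + t\<^sup>2) / cosh (\<delta> * t)) \<le> \<bar>B\<bar> * ((2 / m ^ 4) * inverse (1 + t\<^sup>2))"
      by (intro mult_left_mono) auto
    moreover have "norm (f t) \<le> \<bar>B\<bar> * ((1 + t\<^sup>2) / cosh (\<delta> * t))"
      using bound[of t] mult_right_mono[OF abs_ge_self[of B], of "(1 + t\<^sup>2) / cosh (\<delta> * t)"] by simp
    ultimately show "norm (f t) \<le> norm (\<bar>B\<bar> * (2 / m ^ 4) * inverse (1 + t\<^sup>2))"
      using m by (simp add: abs_mult mult.assoc)
  qed
qed

text \<open>The left side is the absolute value of the real part of \<open>sin z\<close>. The bound
  serves vertical lines, where \<open>Re z\<close> is fixed and the sine factor is not 0.\<close>

lemma norm_sin_ge_cosh: "\<bar>sin (Re z)\<bar> * cosh (Im z) \<le> norm (sin z)"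
proof -
  have "\<bar>Re (sin z)\<bar> = \<bar>sin (Re z)\<bar> * cosh (Im z)"
    by (simp add: Re_sin cosh_def abs_mult)
  then show ?thesis using abs_Re_le_cmod[of "sin z"] by simp
qed

text \<open>The reverse triangle inequality for the two exponentials gives a bound uniform in
  \<open>Re z\<close>, as required on horizontal sides, along which the real sine factor passes
  through 0.\<close>

lemma norm_sin_ge_sinh: "sinh \<bar>Im z\<bar> \<le> norm (sin z)"
proof -
  have "sinh \<bar>Im z\<bar> = \<bar>norm (exp (\<i> * z)) - norm (exp (- (\<i> * z)))\<bar> / 2"
    by (simp add: sinh_def abs_if)
  also have "\<dots> \<le> norm (exp (\<i> * z) - exp (- (\<i> * z))) / 2"
    using norm_triangle_ineq3[of "exp (\<i> * z)" "exp (- (\<i> * z))"] by simp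
  also have "\<dots> = norm (sin z)"
    by (simp add: sin_exp_eq norm_divide norm_mult)
  finally show ?thesis .
qed

section \<open>Mellin inversion of \<open>1 / (1 + X)\<close> by residues\<close>

lemma sin_pi_eq_0_strip:
  assumes "sin (complex_of_real pi * s) = 0" and "0 < Re s" and "Re s < 2"
  shows "s = 1"
proof -
  obtain n :: int where "complex_of_real pi * s = of_real (of_int n * pi)"
    using assms(1) by (auto simp: sin_eq_0)
  then have "s = of_int n" by simp
  moreover from this have "n = 1" using assms by auto
  ultimately show ?thesis by simp
qed

lemma sin_pi_mult_pos: "0 < c \<Longrightarrow> c < 1 \<Longrightarrow> sin (pi * c) > 0"
  by (intro sin_gt_zero) auto

text \<open>The integrand changes by the factor \<open>- exp v\<close> under \<open>s \<mapsto> s + 1\<close>, so the two vertical sides of a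
  rectangle of width 1 around the pole at 1 contribute proportional integrals.\<close>

lemma exp_over_sin_rectangle:
  fixes v c T :: real
  defines "h \<equiv> \<lambda>s. exp (complex_of_real v * s) / sin (complex_of_real pi * s)"
  assumes c: "0 < c" "c < 1" and T: "T > 0"
  shows "norm ((1 + exp (complex_of_real v)) * integral {-T..T} (\<lambda>u. h (Complex c u)) - 2 * exp (complex_of_real v))
    \<le> 2 * (exp (2 * \<bar>v\<bar>) / sinh (pi * T))"
proof -
  define S where "S = {s. 0 < Re s} \<inter> {s. Re s < 2}"
  have S: "open S" "connected S" "1 \<in> S"
    unfolding S_def
    by (auto intro!: open_Int open_halfspace_Re_gt open_halfspace_Re_lt convex_connected convex_Int
         convex_halfspace_Re_gt convex_halfspace_Re_lt)
  define a1 a2 a3 a4 where "a1 = Complex c (- T)" and "a2 = Complex (c + 1) (- T)"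
    and "a3 = Complex (c + 1) T" and "a4 = Complex c T"
  note a_defs = a1_def a2_def a3_def a4_def
  have sub: "path_image (rectpath a1 a3) \<subseteq> S - {1}"
    using c T by (auto simp: path_image_rectpath a_defs S_def)
  have hol: "h holomorphic_on S - {1}"
    unfolding h_def using sin_pi_eq_0_strip by (intro holomorphic_intros) (auto simp: S_def)
  have "residue h 1 = exp (complex_of_real v * 1) / (- complex_of_real pi)"
    unfolding h_def
  proof (rule residue_simple_pole_deriv[OF _ _ S])
    have "((\<lambda>s. sin (complex_of_real pi * s)) has_field_derivative complex_of_real pi * cos (complex_of_real pi * 1)) (at 1)"
      by (auto intro!: derivative_eq_intros)
    then show "((\<lambda>s. sin (complex_of_real pi * s)) has_field_derivative - complex_of_real pi) (at 1)"
      by (simp add: cos_of_real)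
  qed (auto intro!: holomorphic_intros simp: sin_of_real)
  then have res: "residue h 1 = - (exp v / pi)" by (simp add: exp_of_real)
  have outside: "winding_number (rectpath a1 a3) z = 0" if "z \<notin> S" for z
    using that c T by (intro winding_number_rectpath_outside) (auto simp: a_defs S_def in_cbox_complex_iff)
  have inside: "winding_number (rectpath a1 a3) 1 = 1"
    using c T by (intro winding_number_rectpath) (auto simp: a_defs in_box_complex_iff)
  have total: "contour_integral (rectpath a1 a3) h = - (2 * \<i> * exp (complex_of_real v))"
    using Residue_theorem[OF S(1,2) _ hol _ _ sub, simplified] outside inside res
    by (simp add: exp_of_real)
  have image: "path_image (rectpath a1 a3) = closed_segment a1 a2 \<union> closed_segment a2 a3 \<union> closed_segment a3 a4 \<union> closed_segment a4 a1"
    by (simp add: rectpath_def Let_def path_image_join a_defs Un_assoc)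
  have cont: "continuous_on (closed_segment x y) h"
    if "closed_segment x y \<subseteq> path_image (rectpath a1 a3)" for x y
    using holomorphic_on_imp_continuous_on[OF hol] continuous_on_subset sub that by (meson order_trans)
  have conts: "continuous_on (closed_segment a1 a2) h" "continuous_on (closed_segment a2 a3) h"
    "continuous_on (closed_segment a3 a4) h" "continuous_on (closed_segment a4 a1) h"
    by (intro cont; auto simp: image)+
  note ints = conts[THEN contour_integrable_continuous_linepath]
  have "contour_integral (rectpath a1 a3) h = contour_integral (linepath a1 a2) h + contour_integral (linepath a2 a3) h
      + contour_integral (linepath a3 a4) h + contour_integral (linepath a4 a1) h"
  proof -
    have "rectpath a1 a3 = linepath a1 a2 +++ linepath a2 a3 +++ linepath a3 a4 +++ linepath a4 a1"
      by (simp add: rectpath_def Let_def a_defs)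
    then show ?thesis
      by (simp add: contour_integral_join ints contour_integrable_join valid_path_join add.assoc)
  qed
  moreover have "contour_integral (linepath a4 a1) h = - (\<i> * integral {-T..T} (\<lambda>u. h (Complex c u)))"
  proof -
    have "contour_integral (linepath a4 a1) h = - contour_integral (linepath a1 a4) h"
      using contour_integral_reverse_linepath[of a1 a4 h] conts(4) by (simp add: closed_segment_commute)
    also have "contour_integral (linepath a1 a4) h = \<i> * integral {-T..T} (\<lambda>u. h (Complex c u))"
      by (rule contour_integral_linepath_same_Re) (use T in \<open>auto simp: a_defs\<close>)
    finally show ?thesis .
  qed
  moreover have "contour_integral (linepath a2 a3) h = - (exp v * (\<i> * integral {-T..T} (\<lambda>u. h (Complex c u))))"
  proof -
    have "h (Complex (c + 1) u) = - (exp v * h (Complex c u))" for u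
    proof -
      have eq: "Complex (c + 1) u = Complex c u + 1" by (simp add: complex_eq_iff)
      show ?thesis
        unfolding h_def eq by (simp add: distrib_left exp_add exp_of_real sin_add sin_of_real cos_of_real)
    qed
    moreover have "contour_integral (linepath a2 a3) h = \<i> * integral {-T..T} (\<lambda>u. h (Complex (c + 1) u))"
      by (rule contour_integral_linepath_same_Re) (use T in \<open>auto simp: a_defs\<close>)
    ultimately show ?thesis by simp
  qed
  \<comment> \<open>The left side contributes \<open>- \<i>\<close> and the right side
    \<open>- \<i> * exp v\<close> times the same integral, and the residue accounts for
    \<open>- 2 * \<i> * exp v\<close>; the horizontal sides are the whole error.\<close>
  ultimately have "\<i> * ((1 + exp v) * integral {-T..T} (\<lambda>u. h (Complex c u)) - 2 * exp (complex_of_real v))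
      = contour_integral (linepath a1 a2) h + contour_integral (linepath a3 a4) h"
    using total by (simp add: algebra_simps)
  then have "norm ((1 + exp v) * integral {-T..T} (\<lambda>u. h (Complex c u)) - 2 * exp (complex_of_real v))
      \<le> norm (contour_integral (linepath a1 a2) h) + norm (contour_integral (linepath a3 a4) h)"
    by (metis (no_types, lifting) norm_ii norm_mult mult_1 norm_triangle_ineq)
  moreover have bound: "norm (h s) \<le> exp (2 * \<bar>v\<bar>) / sinh (pi * T)" if "Im s = T \<or> Im s = - T" "c \<le> Re s" "Re s \<le> c + 1" for s
  proof -
    have "v * Re s \<le> \<bar>v\<bar> * \<bar>Re s\<bar>" by (metis abs_ge_self abs_mult)
    also have "\<dots> \<le> \<bar>v\<bar> * 2" using that c by (intro mult_left_mono) auto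
    finally have "norm (exp (complex_of_real v * s)) \<le> exp (2 * \<bar>v\<bar>)" by simp
    moreover have "sinh (pi * T) \<le> norm (sin (complex_of_real pi * s))"
      using norm_sin_ge_sinh[of "complex_of_real pi * s"] that T by (auto simp: abs_mult)
    moreover have "sinh (pi * T) > 0" using T by simp
    ultimately show ?thesis
      unfolding h_def norm_divide by (intro frac_le) auto
  qed
  moreover have "norm (contour_integral (linepath a1 a2) h) \<le> exp (2 * \<bar>v\<bar>) / sinh (pi * T) * norm (a2 - a1)"
  proof (rule contour_integral_bound_linepath[OF ints(1)])
    show "norm (h s) \<le> exp (2 * \<bar>v\<bar>) / sinh (pi * T)" if "s \<in> closed_segment a1 a2" for s
      using that by (intro bound) (auto simp: a_defs closed_segment_same_Im closed_segment_eq_real_ivl)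
  qed (use T in auto)
  moreover have "norm (contour_integral (linepath a3 a4) h) \<le> exp (2 * \<bar>v\<bar>) / sinh (pi * T) * norm (a4 - a3)"
  proof (rule contour_integral_bound_linepath[OF ints(3)])
    show "norm (h s) \<le> exp (2 * \<bar>v\<bar>) / sinh (pi * T)" if "s \<in> closed_segment a3 a4" for s
      using that by (intro bound) (auto simp: a_defs closed_segment_same_Im closed_segment_eq_real_ivl)
  qed (use T in auto)
  moreover have "norm (a2 - a1) = 1" "norm (a4 - a3) = 1"
    by (simp_all add: a_defs cmod_def)
  ultimately show ?thesis by (simp add: exp_of_real)
qed

lemma continuous_on_exp_over_sin:
  assumes "0 < c" "c < 1"
  shows "continuous_on UNIV (\<lambda>u. exp (complex_of_real v * Complex c u) / sin (complex_of_real pi * Complex c u))"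
proof -
  have "sin (complex_of_real pi * Complex c u) \<noteq> 0" for u
    using sin_pi_eq_0_strip[of "Complex c u"] assms by (auto simp: complex_eq_iff)
  then show ?thesis by (intro continuous_intros) (auto simp: Complex_eq intro!: continuous_intros)
qed

lemma norm_exp_over_sin_le:
  assumes "0 < c" "c < 1"
  shows "norm (exp (complex_of_real v * Complex c u) / sin (complex_of_real pi * Complex c u))
     \<le> exp (v * c) / sin (pi * c) / cosh (pi * u)"
proof -
  have "sin (pi * c) > 0" using assms by (rule sin_pi_mult_pos)
  moreover from this have "sin (pi * c) * cosh (pi * u) \<le> norm (sin (complex_of_real pi * Complex c u))"
    using norm_sin_ge_cosh[of "complex_of_real pi * Complex c u"] by simp
  ultimately show ?thesis
    by (simp add: norm_divide frac_le)
qed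

lemma integrable_exp_over_sin:
  assumes "0 < c" "c < 1"
  shows "integrable lborel (\<lambda>u. exp (complex_of_real v * Complex c u) / sin (complex_of_real pi * Complex c u))"
proof (rule integrable_quadratic_over_cosh[OF pi_gt_zero continuous_on_exp_over_sin[OF assms]])
  fix u :: real
  have "sin (pi * c) > 0" using assms by (rule sin_pi_mult_pos)
  then have "exp (v * c) / sin (pi * c) * 1 \<le> exp (v * c) / sin (pi * c) * (1 + u\<^sup>2)"
    by (intro mult_left_mono) auto
  then have "exp (v * c) / sin (pi * c) / cosh (pi * u) \<le> exp (v * c) / sin (pi * c) * (1 + u\<^sup>2) / cosh (pi * u)"
    by (intro divide_right_mono) auto
  then show "norm (exp (complex_of_real v * Complex c u) / sin (complex_of_real pi * Complex c u))
     \<le> exp (v * c) / sin (pi * c) * (1 + u\<^sup>2) / cosh (pi * u)"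
    using norm_exp_over_sin_le[OF assms, of v u] by linarith
qed

text \<open>The rectangle estimate is taken along growing heights, where
  \<open>sinh (pi * T)\<close> kills the error, and dominated convergence identifies the limit with
  the Lebesgue integral. With \<open>X = exp (- v)\<close> this is the Mellin inversion formula for
  \<open>1 / (1 + X)\<close>.\<close>

lemma integral_exp_over_sin:
  assumes "0 < c" "c < 1"
  shows "(LBINT u. exp (complex_of_real v * Complex c u) / sin (complex_of_real pi * Complex c u))
     = 2 / (1 + exp (- complex_of_real v))"
proof -
  define f where "f = (\<lambda>u. exp (complex_of_real v * Complex c u) / sin (complex_of_real pi * Complex c u))"
  have f: "integrable lborel f" unfolding f_def by (rule integrable_exp_over_sin[OF assms])
  define J where "J = (\<lambda>n. integral {- real (Suc n)..real (Suc n)} f)"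
  have "(\<lambda>n. LBINT u. indicator {- real (Suc n)..real (Suc n)} u *\<^sub>R f u) \<longlonglongrightarrow> (LBINT u. f u)"
  proof (rule integral_dominated_convergence)
    show "integrable lborel (\<lambda>u. norm (f u))" using f by simp
    show "AE u in lborel. (\<lambda>n. indicator {- real (Suc n)..real (Suc n)} u *\<^sub>R f u) \<longlonglongrightarrow> f u"
    proof (intro AE_I2)
      fix u :: real
      have "\<forall>\<^sub>F n in sequentially. indicator {- real (Suc n)..real (Suc n)} u *\<^sub>R f u = f u"
        using eventually_ge_at_top[of "nat \<lceil>\<bar>u\<bar>\<rceil>"]
        by eventually_elim (auto simp: indicator_def)
      then show "(\<lambda>n. indicator {- real (Suc n)..real (Suc n)} u *\<^sub>R f u) \<longlonglongrightarrow> f u"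
        by (rule tendsto_eventually)
    qed
  qed (use f in \<open>auto simp: indicator_def\<close>)
  moreover have "(LBINT u. indicator {- real (Suc n)..real (Suc n)} u *\<^sub>R f u) = J n" for n
  proof -
    have "set_integrable lborel {- real (Suc n)..real (Suc n)} f"
      unfolding set_integrable_def by (rule integrable_mult_indicator[OF _ f]) simp
    from set_borel_integral_eq_integral(2)[OF this] show ?thesis
      by (simp add: J_def set_lebesgue_integral_def)
  qed
  ultimately have J: "J \<longlonglongrightarrow> (LBINT u. f u)" by simp
  have "(\<lambda>n. (1 + exp (complex_of_real v)) * J n - 2 * exp (complex_of_real v)) \<longlonglongrightarrow> 0"
  proof (rule Lim_null_comparison)
    show "\<forall>\<^sub>F n in sequentially. norm ((1 + exp (complex_of_real v)) * J n - 2 * exp (complex_of_real v))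
        \<le> 2 * (exp (2 * \<bar>v\<bar>) / sinh (pi * real (Suc n)))"
      unfolding J_def f_def by (intro always_eventually allI exp_over_sin_rectangle assms) auto
    show "(\<lambda>n. 2 * (exp (2 * \<bar>v\<bar>) / sinh (pi * real (Suc n)))) \<longlonglongrightarrow> 0"
      by real_asymp
  qed
  moreover have "(\<lambda>n. (1 + exp (complex_of_real v)) * J n - 2 * exp (complex_of_real v))
      \<longlonglongrightarrow> (1 + exp (complex_of_real v)) * (LBINT u. f u) - 2 * exp (complex_of_real v)"
    by (intro tendsto_intros J)
  ultimately have "(1 + exp (complex_of_real v)) * (LBINT u. f u) - 2 * exp (complex_of_real v) = 0"
    using LIMSEQ_unique by blast
  moreover have nz: "1 + exp (complex_of_real v) \<noteq> 0"
    using exp_gt_zero[of v] by (metis add_pos_pos exp_of_real less_numeral_extra(3) of_real_1 of_real_add of_real_eq_0_iff zero_less_one)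
  ultimately have "(LBINT u. f u) = 2 * exp (complex_of_real v) / (1 + exp (complex_of_real v))"
    by (simp add: field_simps)
  also have "\<dots> = 2 / (1 + exp (- complex_of_real v))"
    using nz by (simp add: exp_minus field_simps)
  finally show ?thesis unfolding f_def .
qed

text \<open>The two arguments differ by \<open>pi / 2\<close>. In the sine form the variable
  \<open>u = (s - 1) / (2 * k)\<close> carries the line of integration into the strip between the
  zeros 0 and 1 of \<open>sin (pi * u)\<close>.\<close>

lemma kernel_denominator_eq:
  assumes "k \<ge> 1"
  shows "2 * of_nat k * cos (complex_of_real pi * (s + of_nat k - 1) / (2 * of_nat k))
    = - (2 * of_nat k * sin (complex_of_real pi * ((s - 1) / (2 * of_nat k))))"
proof -
  have "complex_of_real pi * (s + of_nat k - 1) / (2 * of_nat k)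
      = complex_of_real pi * ((s - 1) / (2 * of_nat k)) + complex_of_real (pi / 2)"
    using assms by (simp add: field_simps)
  then show ?thesis
    by (simp only: cos_add cos_of_real sin_of_real) simp
qed

section \<open>The kernel as a series\<close>

context
  fixes c x :: real and k :: nat
  assumes c: "1 < c" "c < 2" and x: "x > 0" and k: "k \<ge> 1"
begin

text \<open>All of the integrand except the zeta factor, with the opposite sign, since the cosine
  factor of the kernel is minus this sine.\<close>

private definition weight :: "real \<Rightarrow> complex" where
  "weight t = complex_of_real x powr (- Complex c t)
     / (2 * of_nat k * sin (complex_of_real pi * ((Complex c t - 1) / (2 * of_nat k))))"

private definition c' :: real where
  "c' = (c - 1) / (2 * real k)"

private lemma c'_range: "0 < c'" "c' < 1"
  using c k by (auto simp: c'_def field_simps)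

private lemma Complex_shift: "(Complex c t - 1) / (2 * of_nat k) = Complex c' (t / (2 * real k))"
proof -
  have "2 * of_nat k * Complex c' (t / (2 * real k)) = Complex c t - 1"
    using k by (simp add: complex_eq_iff c'_def)
  then show ?thesis using k by (simp add: field_simps)
qed

private lemma sin_nonzero: "sin (complex_of_real pi * ((Complex c t - 1) / (2 * of_nat k))) \<noteq> 0"
  unfolding Complex_shift
  using sin_pi_eq_0_strip[of "Complex c' (t / (2 * real k))"] c'_range by (auto simp: complex_eq_iff)

private lemma continuous_on_Complex: "continuous_on UNIV (\<lambda>t. Complex c t)"
  by (auto simp: Complex_eq intro!: continuous_intros)

private lemma continuous_on_weight: "continuous_on UNIV weight"
  unfolding weight_def using sin_nonzero k x
  by (intro continuous_intros continuous_on_Complex) auto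

private lemma norm_weight_le:
  "norm (weight t) \<le> x powr - c / (2 * real k * sin (pi * c')) / cosh (pi / (2 * real k) * t)"
proof -
  have "sin (pi * c') > 0" using c'_range by (rule sin_pi_mult_pos)
  moreover have "sin (pi * c') * cosh (pi / (2 * real k) * t)
      \<le> norm (sin (complex_of_real pi * ((Complex c t - 1) / (2 * of_nat k))))"
    using norm_sin_ge_cosh[of "complex_of_real pi * Complex c' (t / (2 * real k))"]
      sin_pi_mult_pos[OF c'_range]
    unfolding Complex_shift by simp
  moreover have "norm (complex_of_real x powr (- Complex c t)) = x powr - c"
    using x by (simp add: norm_powr_real_powr)
  ultimately show ?thesis
    using k unfolding weight_def norm_divide norm_mult
    by (simp add: frac_le)
qed

text \<open>The powers combine to \<open>1 / x\<close> times a pure exponential in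
  \<open>(s - 1) / (2 * k)\<close>, and the substitution \<open>t = 2 * k * u\<close> reduces the
  integral to \<open>integral_exp_over_sin\<close>.\<close>

private lemma has_integral_powr_weight:
  assumes y: "y > 0"
  shows "has_bochner_integral lborel (\<lambda>t. of_real y powr - (1 - Complex c t) * weight t)
    (of_real (2 * y ^ (2 * k) / (x * (x ^ (2 * k) + y ^ (2 * k)))))"
proof -
  \<comment> \<open>With this choice \<open>exp (- v)\<close> is
    \<open>(x / y) ^ (2 * k)\<close>.\<close>
  define v where "v = 2 * real k * (ln y - ln x)"
  define E where "E = (\<lambda>u. exp (complex_of_real v * Complex c' u) / sin (complex_of_real pi * Complex c' u))"
  define f where "f = (\<lambda>t. of_real y powr - (1 - Complex c t) * weight t)"
  \<comment> \<open>The summand 0 gives the argument the affine shape that the substitution rule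
    expects.\<close>
  have f: "f (0 + 2 * real k * u) = 1 / (of_real x * (2 * of_nat k)) * E u" for u
  proof -
    define s where "s = Complex c (2 * real k * u)"
    have s: "(s - 1) / (2 * of_nat k) = Complex c' u"
      unfolding s_def Complex_shift using k by simp
    then have s': "s - 1 = 2 * of_nat k * Complex c' u"
      using k by (simp add: field_simps)
    have "complex_of_real y powr - (1 - s) * of_real x powr - s
        = exp ((s - 1) * of_real (ln y)) * exp (- s * of_real (ln x))"
      using x y by (simp add: powr_def Ln_of_real)
    also have "\<dots> = exp (of_real v * Complex c' u) * exp (- of_real (ln x))"
    proof -
      have "(s - 1) * of_real (ln y) + - s * of_real (ln x) = (s - 1) * of_real (ln y - ln x) - of_real (ln x)"
        by (simp add: algebra_simps)
      also have "\<dots> = of_real v * Complex c' u + - of_real (ln x)"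
        unfolding s' v_def by simp
      finally show ?thesis by (simp only: exp_add[symmetric])
    qed
    also have "exp (- complex_of_real (ln x)) = 1 / of_real x"
      using x by (simp add: exp_minus exp_of_real inverse_eq_divide)
    finally have "complex_of_real y powr - (1 - s) * of_real x powr - s = exp (of_real v * Complex c' u) * (1 / of_real x)" .
    moreover have "f (0 + 2 * real k * u) = (of_real y powr - (1 - s) * of_real x powr - s)
        / (2 * of_nat k * sin (complex_of_real pi * ((s - 1) / (2 * of_nat k))))"
      by (simp add: f_def weight_def s_def)
    ultimately show ?thesis
      unfolding s E_def by simp
  qed
  have E: "integrable lborel E" "integral\<^sup>L lborel E = 2 / (1 + exp (- complex_of_real v))"
    unfolding E_def by (rule integrable_exp_over_sin[OF c'_range], rule integral_exp_over_sin[OF c'_range])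
  have nz: "2 * real k \<noteq> 0" using k by simp
  have "integrable lborel (\<lambda>u. f (0 + 2 * real k * u))"
    unfolding f using E(1) by simp
  then have "integrable lborel f"
    using lborel_integrable_real_affine_iff[OF nz, of f 0] by simp
  moreover have "integral\<^sup>L lborel f = \<bar>2 * real k\<bar> *\<^sub>R (LBINT u. f (0 + 2 * real k * u))"
    by (rule lborel_integral_real_affine[OF nz])
  moreover have "\<dots> = 2 / (of_real x * (1 + exp (- complex_of_real v)))"
    unfolding f using E(2) k by (simp add: scaleR_conv_of_real)
  moreover have "\<dots> = of_real (2 * y ^ (2 * k) / (x * (x ^ (2 * k) + y ^ (2 * k))))"
  proof -
    have "exp (- v) = x ^ (2 * k) / y ^ (2 * k)"
    proof -
      have "- v = of_nat (2 * k) * ln x - of_nat (2 * k) * ln y"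
        by (simp add: v_def algebra_simps)
      then show ?thesis using x y by (simp only: exp_diff exp_of_nat_mult exp_ln)
    qed
    moreover have "2 / (complex_of_real x * (1 + exp (- complex_of_real v))) = of_real (2 / (x * (1 + exp (- v))))"
      by (simp add: exp_of_real[symmetric])
    moreover have "2 / (x * (1 + x ^ (2 * k) / y ^ (2 * k))) = 2 * y ^ (2 * k) / (x * (x ^ (2 * k) + y ^ (2 * k)))"
      using x y by (simp add: field_simps)
    ultimately show ?thesis by simp
  qed
  ultimately show ?thesis
    by (simp add: has_bochner_integral_iff f_def)
qed

text \<open>The two-step Euler series of the zeta factor is integrated termwise. A base
  \<open>y\<close> contributes \<open>2 / x - g y\<close>; the constant \<open>2 / x\<close> cancels
  in every difference, so it survives only in the first Euler term and becomes
  \<open>- 1 / (2 * pi * x)\<close>.\<close>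

lemma alt_hurwitz_kernel_eq:
  assumes a: "a > 0"
  shows "alt_hurwitz_kernel c x a k = of_real (- 1 / (2 * pi * x)
    + x ^ (2 * k - 1) / pi * (\<Sum>n. (-1) ^ n / ((real n + a) ^ (2 * k) + x ^ (2 * k))))"
proof -
  define F where "F = (\<lambda>m y t. powr_diff m (1 - Complex c t) (of_real y) * weight t)"
  define g where "g = (\<lambda>y. 2 * x ^ (2 * k - 1) / (y ^ (2 * k) + x ^ (2 * k)))"
  have pow: "x ^ (2 * k) = x * x ^ (2 * k - 1)"
    using k by (cases k) auto
  have int0: "has_bochner_integral lborel (F 0 y) (of_real (2 / x - g y))" if "y > 0" for y
  proof -
    have pos: "x ^ (2 * k) + y ^ (2 * k) > 0" using x that by (simp add: add_pos_pos)
    have "2 / x - g y = 2 * y ^ (2 * k) / (x * (x ^ (2 * k) + y ^ (2 * k)))"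
    proof -
      have "x * g y = 2 * x ^ (2 * k) / (x ^ (2 * k) + y ^ (2 * k))"
        by (simp add: g_def pow add.commute)
      then have "x * (2 / x - g y) = 2 - 2 * x ^ (2 * k) / (x ^ (2 * k) + y ^ (2 * k))"
        using x by (simp add: right_diff_distrib)
      also have "\<dots> = 2 * y ^ (2 * k) / (x ^ (2 * k) + y ^ (2 * k))"
        using pos by (simp add: field_simps)
      finally have "2 / x - g y = 2 * y ^ (2 * k) / (x ^ (2 * k) + y ^ (2 * k)) / x"
        using x by (metis less_irrefl nonzero_mult_div_cancel_left)
      then show ?thesis by (simp add: mult.commute)
    qed
    then show ?thesis
      using has_integral_powr_weight[OF that] by (simp only: F_def powr_diff.simps)
  qed
  have int_Suc: "has_bochner_integral lborel (F (Suc m) y) (I - I')"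
    if "has_bochner_integral lborel (F m y) I" "has_bochner_integral lborel (F m (y + 1)) I'" for m y I I'
    using has_bochner_integral_diff[OF that] by (simp add: F_def left_diff_distrib)
  have int1: "has_bochner_integral lborel (F 1 y) (of_real (g (y + 1) - g y))" if "y > 0" for y
    using int_Suc[OF int0[OF that] int0[of "y + 1"]] that by simp
  have int2: "has_bochner_integral lborel (F 2 y) (of_real (2 * g (y + 1) - g y - g (y + 1 + 1)))" if "y > 0" for y
    using int_Suc[OF int1[OF that] int1[of "y + 1"]] that by (simp add: numeral_2_eq_2 algebra_simps)

  define W where "W = x powr - c / (2 * real k * sin (pi * c'))"
  \<comment> \<open>Up to the factor \<open>(real n + a) powr (c - 3)\<close>, summable in
    \<open>n\<close> because \<open>c < 2\<close>, this dominates every second-difference term, so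
    one integrability proof serves all \<open>n\<close>.\<close>
  define G where "G = (\<lambda>t. pochhammer (1 - Complex c t) 2 * weight t)"
  have "integrable lborel G"
  proof (rule integrable_quadratic_over_cosh[where \<delta> = "pi / (2 * real k)"])
    show "continuous_on UNIV G"
      unfolding G_def
      by (intro continuous_intros continuous_on_weight continuous_on_Complex
          continuous_on_compose2[OF holomorphic_on_imp_continuous_on[of "\<lambda>z. pochhammer z 2" UNIV]]) (auto intro!: holomorphic_intros)
    fix t :: real
    have "norm (1 - Complex c t) \<le> 1 + \<bar>t\<bar>" "norm (2 - Complex c t) \<le> 1 + \<bar>t\<bar>"
      using c cmod_le[of "1 - Complex c t"] cmod_le[of "2 - Complex c t"] by auto
    then have "norm (pochhammer (1 - Complex c t) 2) \<le> (1 + \<bar>t\<bar>) * (1 + \<bar>t\<bar>)"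
      by (simp add: numeral_2_eq_2 pochhammer_Suc norm_mult mult_mono)
    also have "\<dots> \<le> 2 * (1 + t\<^sup>2)"
      \<comment> \<open>The difference of the two sides is the square of
        \<open>|t| - 1\<close>.\<close>
      using zero_le_power2[of "\<bar>t\<bar> - 1"] by (simp add: power2_eq_square algebra_simps)
    finally have "norm (G t) \<le> 2 * (1 + t\<^sup>2) * (W / cosh (pi / (2 * real k) * t))"
      unfolding G_def norm_mult W_def using norm_weight_le[of t] by (intro mult_mono) auto
    then show "norm (G t) \<le> 2 * W * (1 + t\<^sup>2) / cosh (pi / (2 * real k) * t)"
      by (simp add: mult_ac distrib_left)
  qed (use k in auto)
  then have G: "integrable lborel (\<lambda>t. norm (G t))" by simp

  \<comment> \<open>Two Euler steps suffice: \<open>1 - s\<close> has real part \<open>1 - c > - 1\<close>.\<close>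
  define f where "f = (\<lambda>n t. (-1) ^ n * F 2 (real n + a) t)"
  have f_le: "norm (f n t) \<le> (real n + a) powr (c - 3) * norm (G t)" for n t
  proof -
    have "norm (powr_diff 2 (1 - Complex c t) (of_real (real n + a)))
        \<le> norm (pochhammer (1 - Complex c t) 2) * (real n + a) powr (c - 3)"
      using norm_powr_diff_le[of "real n + a" "1 - Complex c t" 2] a c by (simp add: algebra_simps)
    from mult_right_mono[OF this norm_ge_zero[of "weight t"]] show ?thesis
      by (simp add: f_def F_def G_def norm_mult norm_power mult_ac)
  qed
  have summable: "summable (\<lambda>n. (real n + a) powr (c - 3))"
    using c by (intro summable_shift_powr) auto
  have f_int: "has_bochner_integral lborel (f n)
      (of_real ((-1) ^ n * (2 * g (real n + a + 1) - g (real n + a) - g (real n + a + 1 + 1))))" for n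
  proof -
    have "has_bochner_integral lborel (\<lambda>t. (-1) ^ n * F 2 (real n + a) t)
        ((-1) ^ n * of_real (2 * g (real n + a + 1) - g (real n + a) - g (real n + a + 1 + 1)))"
      using a by (intro has_bochner_integral_mult_right int2) auto
    then show ?thesis by (simp add: f_def)
  qed
  have f_integrable: "integrable lborel (f n)" for n
    using f_int has_bochner_integral_iff by blast
  have f_summable: "summable (\<lambda>n. norm (f n t))" for t
    by (rule summable_comparison_test'[OF summable_mult2[OF summable, of "norm (G t)"]]) (use f_le in simp)
  have "summable (\<lambda>n. LBINT t. norm (f n t))"
  proof (rule summable_comparison_test')
    show "summable (\<lambda>n. (real n + a) powr (c - 3) * (LBINT t. norm (G t)))"
      by (rule summable_mult2[OF summable])
    fix n
    have "(LBINT t. norm (f n t)) \<le> (LBINT t. (real n + a) powr (c - 3) * norm (G t))"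
      using f_le f_integrable G by (intro integral_mono) auto
    then show "norm (LBINT t. norm (f n t)) \<le> (real n + a) powr (c - 3) * (LBINT t. norm (G t))"
      by (simp add: Bochner_Integration.integral_nonneg)
  qed
  note swap = integrable_suminf[OF f_integrable AE_I2[OF f_summable] this]
    sums_integral[OF f_integrable AE_I2[OF f_summable] this]

  define S where "S = (\<Sum>n. (-1) ^ n / ((real n + a) ^ (2 * k) + x ^ (2 * k)))"
  define U where "U = 2 * x ^ (2 * k - 1) * S"
  have lim: "(\<lambda>n. g (real n + a)) \<longlonglongrightarrow> 0"
  and U: "(\<lambda>n. (-1) ^ n * g (real n + a)) sums U"
  proof -
    have sm: "summable (\<lambda>n. norm ((-1) ^ n / ((real n + a) ^ (2 * k) + x ^ (2 * k))))"
    proof (rule summable_comparison_test')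
      show "summable (\<lambda>n. (real n + a) powr - real (2 * k))"
        using k by (intro summable_shift_powr) auto
      fix n
      have "1 / ((real n + a) ^ (2 * k) + x ^ (2 * k)) \<le> 1 / (real n + a) ^ (2 * k)"
        using a x by (intro frac_le) auto
      moreover have "(real n + a) powr - real (2 * k) = 1 / (real n + a) ^ (2 * k)"
        using a by (simp add: powr_minus powr_realpow add_nonneg_pos inverse_eq_divide del: of_nat_mult)
      ultimately show "norm (norm ((-1) ^ n / ((real n + a) ^ (2 * k) + x ^ (2 * k)))) \<le> (real n + a) powr - real (2 * k)"
        using a x by (simp add: norm_divide norm_power del: of_nat_mult)
    qed
    have "(\<lambda>n. 2 * x ^ (2 * k - 1) * norm ((-1) ^ n / ((real n + a) ^ (2 * k) + x ^ (2 * k)))) \<longlonglongrightarrow> 2 * x ^ (2 * k - 1) * 0"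
      by (intro tendsto_intros summable_LIMSEQ_zero sm)
    then show "(\<lambda>n. g (real n + a)) \<longlonglongrightarrow> 0"
      using a x by (simp add: g_def norm_divide norm_power)
    show "(\<lambda>n. (-1) ^ n * g (real n + a)) sums U"
      using sums_mult[OF summable_sums[OF summable_norm_cancel[OF sm]], of "2 * x ^ (2 * k - 1)"]
      by (simp add: g_def U_def S_def mult_ac)
  qed
  \<comment> \<open>The two Euler steps are undone here: from the sum \<open>U\<close> of the plain
    series, the telescoping equivalence computes the sums of the first and then of the second
    differences.\<close>
  have U1: "(\<lambda>n. (-1) ^ n * (g (real n + a) - g (real n + a + 1))) sums (2 * U - g a)"
    using sums_alternating_telescope[OF lim, of "2 * U - g a"] U by (simp add: add_ac)
  have lim1: "(\<lambda>n. g (real n + a) - g (real n + a + 1)) \<longlonglongrightarrow> 0"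
    using tendsto_diff[OF lim LIMSEQ_Suc[OF lim]] by (simp add: add_ac)
  have U2: "(\<lambda>n. (-1) ^ n * (g (real n + a) - g (real n + a + 1) - (g (real n + a + 1) - g (real n + a + 1 + 1))))
      sums (2 * (2 * U - g a) - (g a - g (a + 1)))"
    using sums_alternating_telescope[OF lim1, of "2 * (2 * U - g a) - (g a - g (a + 1))"] U1
    by (simp add: add_ac diff_divide_distrib)
  have "(\<lambda>n. complex_of_real ((-1) ^ n * (2 * g (real n + a + 1) - g (real n + a) - g (real n + a + 1 + 1))))
      sums of_real (- (2 * (2 * U - g a) - (g a - g (a + 1))))"
    using sums_of_real[OF sums_minus[OF U2], where ?'a = complex] by (simp add: algebra_simps)
  moreover have "integral\<^sup>L lborel (f n) = of_real ((-1) ^ n * (2 * g (real n + a + 1) - g (real n + a) - g (real n + a + 1 + 1)))" for n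
    by (rule has_bochner_integral_integral_eq[OF f_int])
  ultimately have tail: "has_bochner_integral lborel (\<lambda>t. \<Sum>n. f n t) (of_real (- (2 * (2 * U - g a) - (g a - g (a + 1)))))"
    using swap by (simp add: has_bochner_integral_iff sums_iff)
  \<comment> \<open>The weights \<open>1 / 2\<close>, \<open>1 / 4\<close> and \<open>1 / 4\<close>
    are those of \<open>euler_zeta 2\<close>. In the combined value every occurrence of
    \<open>g\<close> outside \<open>U\<close> cancels.\<close>
  have "has_bochner_integral lborel (\<lambda>t. F 0 a t / 2 + F 1 a t / 4 + (\<Sum>n. f n t) / 4)
      (of_real (2 / x - g a) / 2 + of_real (g (a + 1) - g a) / 4 + of_real (- (2 * (2 * U - g a) - (g a - g (a + 1)))) / 4)"
    by (intro has_bochner_integral_add has_bochner_integral_divide_zero int0 int1 tail a)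
  moreover have "of_real (2 / x - g a) / 2 + of_real (g (a + 1) - g a) / 4 + of_real (- (2 * (2 * U - g a) - (g a - g (a + 1)))) / 4
     = complex_of_real (1 / x - U)"
    by (simp add: field_simps)
  moreover have "F 0 a t / 2 + F 1 a t / 4 + (\<Sum>n. f n t) / 4
     = - (alt_hurwitz_zeta (1 - Complex c t) a
         / (2 * of_nat k * cos (complex_of_real pi * (Complex c t + of_nat k - 1) / (2 * of_nat k)))
         * complex_of_real x powr (- Complex c t))" for t
  proof -
    have "summable (\<lambda>n. (-1) ^ n * powr_diff 2 (1 - Complex c t) (of_real (real n + a)))"
      using a c by (intro summable_powr_diff) auto
    from suminf_mult2[OF this, of "weight t"]
    have "(\<Sum>n. f n t) = (\<Sum>n. (-1) ^ n * powr_diff 2 (1 - Complex c t) (of_real (real n + a))) * weight t"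
      by (simp add: f_def F_def mult.assoc)
    moreover have "alt_hurwitz_zeta (1 - Complex c t) a = euler_zeta 2 a (1 - Complex c t)"
      using a c by (intro alt_hurwitz_zeta_eq_euler_zeta) auto
    ultimately have "F 0 a t / 2 + F 1 a t / 4 + (\<Sum>n. f n t) / 4 = alt_hurwitz_zeta (1 - Complex c t) a * weight t"
      by (simp add: euler_zeta_def F_def numeral_2_eq_2 distrib_right del: powr_diff.simps)
    then show ?thesis
      unfolding kernel_denominator_eq[OF k] by (simp add: weight_def)
  qed
  ultimately have "has_bochner_integral lborel (\<lambda>t. - (alt_hurwitz_zeta (1 - Complex c t) a
         / (2 * of_nat k * cos (complex_of_real pi * (Complex c t + of_nat k - 1) / (2 * of_nat k)))
         * complex_of_real x powr (- Complex c t))) (of_real (1 / x - U))"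
    by simp
  from has_bochner_integral_integral_eq[OF has_bochner_integral_minus[OF this]]
  have "alt_hurwitz_kernel c x a k = 1 / (2 * complex_of_real pi * \<i>) * (\<i> * of_real (U - 1 / x))"
    unfolding alt_hurwitz_kernel_def vertical_line_integral_def by simp
  also have "\<dots> = of_real ((U - 1 / x) / (2 * pi))"
    by simp
  also have "(U - 1 / x) / (2 * pi) = - 1 / (2 * pi * x) + x ^ (2 * k - 1) / pi * S"
    using x by (simp add: U_def field_simps)
  finally show ?thesis unfolding S_def .
qed

end

section \<open>Reciprocity of the double series\<close>

text \<open>A product majorant makes the family absolutely summable on the product set, where
  unordered sums may be iterated in either order; the rest translates between unordered sums and
  \<open>sums\<close>.\<close>

lemma double_series:
  fixes f :: "nat \<Rightarrow> nat \<Rightarrow> real"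
  assumes g: "summable g" and h: "summable h"
    and bound: "\<And>n m. \<bar>f n m\<bar> \<le> g n * h m" and nonneg: "\<And>n. g n \<ge> 0" "\<And>m. h m \<ge> 0"
  obtains T where "\<And>n. summable (f n)" and "(\<lambda>n. \<Sum>m. f n m) sums T"
    and "\<And>m. summable (\<lambda>n. f n m)" and "(\<lambda>m. \<Sum>n. f n m) sums T"
proof -
  \<comment> \<open>Stated for arbitrary data so that it applies both to \<open>f\<close> and to its
    transpose.\<close>
  have *: "summable (f n)" "(\<lambda>n. \<Sum>m. f n m) sums infsum (\<lambda>(n, m). f n m) (UNIV \<times> UNIV)"
    "(\<lambda>(n, m). f n m) summable_on UNIV \<times> UNIV"
    if g: "summable g" and h: "summable h" and bound: "\<And>n m. \<bar>f n m\<bar> \<le> g n * h m"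
      and nonneg: "\<And>n. g n \<ge> 0" "\<And>m. h m \<ge> 0"
    for f :: "nat \<Rightarrow> nat \<Rightarrow> real" and g h n
  proof -
    have sn: "summable (\<lambda>m. norm (f n m))" for n
      by (rule summable_comparison_test'[OF summable_mult[OF h, of "g n"]]) (use bound in simp)
    show "summable (f n)" by (rule summable_norm_cancel[OF sn])
    have hs: "((\<lambda>m. f n m) has_sum (\<Sum>m. f n m)) UNIV" for n
      by (rule norm_summable_imp_has_sum[OF sn summable_sums[OF summable_norm_cancel[OF sn]]])
    have "(\<lambda>(n, m). g n * h m) summable_on UNIV \<times> UNIV"
    proof (rule summable_on_SigmaI)
      show "((\<lambda>m. case (n, m) of (n, m) \<Rightarrow> g n * h m) has_sum g n * suminf h) UNIV" for n
        using sums_nonneg_imp_has_sum[OF summable_sums[OF h]] nonneg by (auto intro: has_sum_cmult_right)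
      show "(\<lambda>n. g n * suminf h) summable_on UNIV"
        using summable_nonneg_imp_summable_on[OF g nonneg(1)] by (rule summable_on_cmult_left)
    qed (use nonneg in auto)
    then have "(\<lambda>p. norm (case p of (n, m) \<Rightarrow> f n m)) summable_on UNIV \<times> UNIV"
      by (rule summable_on_comparison_test) (use bound in auto)
    then show sm: "(\<lambda>(n, m). f n m) summable_on UNIV \<times> UNIV"
      by (rule abs_summable_summable)
    have "infsum (f n) UNIV = (\<Sum>m. f n m)" for n
      using hs by (rule infsumI)
    with infsum_Sigma'_banach[OF sm] summable_on_Sigma_banach[OF sm]
    have "((\<lambda>n. \<Sum>m. f n m) has_sum infsum (\<lambda>(n, m). f n m) (UNIV \<times> UNIV)) UNIV"
      by (simp add: has_sum_iff)
    then show "(\<lambda>n. \<Sum>m. f n m) sums infsum (\<lambda>(n, m). f n m) (UNIV \<times> UNIV)"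
      by (rule has_sum_imp_sums)
  qed
  note f = *[OF g h bound nonneg]
  have "\<And>m n. \<bar>f n m\<bar> \<le> h m * g n"
    using bound by (simp add: mult.commute)
  note f' = *[of h g "\<lambda>m n. f n m", OF h g this nonneg(2,1)]
  have "infsum (\<lambda>n. infsum (f n) UNIV) UNIV = infsum (\<lambda>m. infsum (\<lambda>n. f n m) UNIV) UNIV"
    by (rule infsum_swap_banach[OF f(3)])
  then have "infsum (\<lambda>(n, m). f n m) (UNIV \<times> UNIV) = infsum (\<lambda>(m, n). f n m) (UNIV \<times> UNIV)"
    by (simp only: infsum_Sigma'_banach[OF f(3)] infsum_Sigma'_banach[OF f'(3)])
  then show thesis
    using that[of "infsum (\<lambda>(n, m). f n m) (UNIV \<times> UNIV)"] f(1,2) f'(1,2) by metis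
qed

text \<open>With \<open>U\<close> and \<open>V\<close> for the two summands of the bracket, this is
  \<open>\<alpha> ^ (k * N) * U powi (- N) / (U + V)\<close> with a sign. The lattice coordinates
  are \<open>n + 1\<close> and \<open>m + 1\<close>; the two shifts together leave the sign
  unchanged.\<close>

definition lattice_term :: "nat \<Rightarrow> nat \<Rightarrow> real \<Rightarrow> real \<Rightarrow> nat \<Rightarrow> nat \<Rightarrow> real" where
  "lattice_term k N \<alpha> \<beta> n m = (-1) ^ (n + m) / (real (n + 1) ^ (2 * k * N)
     * (\<alpha> ^ k * real (n + 1) ^ (2 * k) + \<beta> ^ k * real (m + 1) ^ (2 * k)))"

text \<open>The \<open>\<alpha>\<close> summand of the denominator is dropped, and the exponents
  \<open>2 * k * N\<close> and \<open>2 * k\<close> are lowered to 2, both being at least 2 for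
  positive \<open>k\<close> and \<open>N\<close>.\<close>

lemma abs_lattice_term_le:
  assumes "\<alpha> > 0" "\<beta> > 0" "k \<ge> 1" "N \<ge> 1"
  shows "\<bar>lattice_term k N \<alpha> \<beta> n m\<bar> \<le> (1 / real (n + 1) ^ 2) * (1 / \<beta> ^ k * (1 / real (m + 1) ^ 2))"
proof -
  have "real (n + 1) ^ 2 \<le> real (n + 1) ^ (2 * k * N)"
    using assms mult_le_mono[of 1 k 1 N] by (intro power_increasing) auto
  moreover have "real (m + 1) ^ 2 \<le> real (m + 1) ^ (2 * k)"
    using assms by (intro power_increasing) auto
  then have "\<beta> ^ k * real (m + 1) ^ 2 \<le> \<beta> ^ k * real (m + 1) ^ (2 * k)"
    using assms by (intro mult_left_mono) auto
  then have "\<beta> ^ k * real (m + 1) ^ 2 \<le> \<alpha> ^ k * real (n + 1) ^ (2 * k) + \<beta> ^ k * real (m + 1) ^ (2 * k)"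
    using assms by (simp add: add_increasing)
  ultimately have "1 / (real (n + 1) ^ (2 * k * N) * (\<alpha> ^ k * real (n + 1) ^ (2 * k) + \<beta> ^ k * real (m + 1) ^ (2 * k)))
      \<le> 1 / (real (n + 1) ^ 2 * (\<beta> ^ k * real (m + 1) ^ 2))"
    using assms by (intro divide_left_mono mult_mono mult_pos_pos add_pos_pos) auto
  moreover have "\<bar>lattice_term k N \<alpha> \<beta> n m\<bar> = 1 / (real (n + 1) ^ (2 * k * N)
     * (\<alpha> ^ k * real (n + 1) ^ (2 * k) + \<beta> ^ k * real (m + 1) ^ (2 * k)))"
    using assms unfolding lattice_term_def abs_divide abs_mult power_abs[symmetric]
    by (simp add: add_nonneg_nonneg power_abs)
  ultimately show ?thesis by simp
qed

lemma lattice_term_series: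
  assumes "\<alpha> > 0" "\<beta> > 0" "k \<ge> 1" "N \<ge> 1"
  obtains T where "\<And>n. summable (lattice_term k N \<alpha> \<beta> n)" and "(\<lambda>n. \<Sum>m. lattice_term k N \<alpha> \<beta> n m) sums T"
    and "\<And>m. summable (\<lambda>n. lattice_term k N \<alpha> \<beta> n m)" and "(\<lambda>m. \<Sum>n. lattice_term k N \<alpha> \<beta> n m) sums T"
proof -
  have s: "summable (\<lambda>n. 1 / real (n + 1) ^ 2)"
    using inverse_squares_sums by (simp add: sums_iff add.commute)
  show thesis
    by (rule double_series[OF s summable_mult[OF s, of "1 / \<beta> ^ k"] abs_lattice_term_le[OF assms]])
       (use assms that in auto)
qed

text \<open>Over a common denominator the numerator is \<open>V ^ N - (- U) ^ N\<close>, which has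
  the factor \<open>U + V\<close>. Cancelling it separates \<open>n\<close> from \<open>m\<close>
  and leaves a finite geometric sum.\<close>

lemma lattice_term_reciprocity:
  assumes "\<alpha> > 0" "\<beta> > 0"
  shows "\<beta> ^ (k * N) * lattice_term k N \<alpha> \<beta> n m - (-1) ^ N * \<alpha> ^ (k * N) * lattice_term k N \<beta> \<alpha> m n
    = (\<Sum>p<N. (-1) ^ p * \<alpha> ^ (k * p) * \<beta> ^ (k * (N - Suc p))
        * ((-1) ^ n / real (n + 1) ^ (2 * k * (N - p))) * ((-1) ^ m / real (m + 1) ^ (2 * k * Suc p)))"
proof -
  define x y where "x = real (n + 1) ^ (2 * k)" and "y = real (m + 1) ^ (2 * k)"
  define U V where "U = \<alpha> ^ k * x" and "V = \<beta> ^ k * y"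
  have pos: "x > 0" "y > 0" "U > 0" "V > 0"
    using assms by (auto simp: x_def y_def U_def V_def)
  have U_pow: "(- U) ^ r = (-1) ^ r * \<alpha> ^ (k * r) * x ^ r" and V_pow: "V ^ r = \<beta> ^ (k * r) * y ^ r" for r
    by (simp_all add: U_def V_def power_minus[of "\<alpha> ^ k * x"] power_mult power_mult_distrib)
  have summand: "V ^ (N - Suc p) * (- U) ^ p / (x ^ N * y ^ N)
      = (-1) ^ p * \<alpha> ^ (k * p) * \<beta> ^ (k * (N - Suc p)) / x ^ (N - p) / y ^ Suc p" if "p < N" for p
  proof -
    have "x ^ N = x ^ p * x ^ (N - p)" "y ^ N = y ^ (N - Suc p) * y ^ Suc p"
      using that by (simp_all del: power_Suc flip: power_add)
    then show ?thesis
      using pos by (simp add: U_pow V_pow del: power_Suc)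
  qed
  have "\<beta> ^ (k * N) / (x ^ N * (U + V)) - (-1) ^ N * \<alpha> ^ (k * N) / (y ^ N * (V + U))
      = (V ^ N - (- U) ^ N) / (x ^ N * y ^ N * (U + V))"
  proof -
    have "A / (X * W) - B / (Y * W) = (A * Y - B * X) / (X * Y * W)"
      if "X > 0" "Y > 0" "W > 0" for A B X Y W :: real
      using that by (simp add: field_simps)
    from this[of "x ^ N" "y ^ N" "U + V"] show ?thesis
      using pos by (simp add: U_pow V_pow add.commute)
  qed
  also have "V ^ N - (- U) ^ N = (U + V) * (\<Sum>p<N. V ^ (N - Suc p) * (- U) ^ p)"
    using power_diff_sumr2[of "- U" N V] by (simp add: algebra_simps)
  also have "\<dots> / (x ^ N * y ^ N * (U + V)) = (\<Sum>p<N. V ^ (N - Suc p) * (- U) ^ p / (x ^ N * y ^ N))"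
    using pos by (simp add: sum_divide_distrib)
  also have "\<dots> = (\<Sum>p<N. (-1) ^ p * \<alpha> ^ (k * p) * \<beta> ^ (k * (N - Suc p)) / x ^ (N - p) / y ^ Suc p)"
    by (intro sum.cong summand) auto
  finally have eq: "\<beta> ^ (k * N) / (x ^ N * (U + V)) - (-1) ^ N * \<alpha> ^ (k * N) / (y ^ N * (V + U))
      = (\<Sum>p<N. (-1) ^ p * \<alpha> ^ (k * p) * \<beta> ^ (k * (N - Suc p)) / x ^ (N - p) / y ^ Suc p)" .
  have "lattice_term k N \<alpha> \<beta> n m = (-1) ^ (n + m) / (x ^ N * (U + V))"
    "lattice_term k N \<beta> \<alpha> m n = (-1) ^ (n + m) / (y ^ N * (V + U))"
    by (simp_all only: lattice_term_def x_def y_def U_def V_def power_mult add.commute[of m n])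
  then have "\<beta> ^ (k * N) * lattice_term k N \<alpha> \<beta> n m - (-1) ^ N * \<alpha> ^ (k * N) * lattice_term k N \<beta> \<alpha> m n
      = (-1) ^ (n + m) * (\<beta> ^ (k * N) / (x ^ N * (U + V)) - (-1) ^ N * \<alpha> ^ (k * N) / (y ^ N * (V + U)))"
    by (simp add: algebra_simps)
  also have "\<dots> = (\<Sum>p<N. (-1) ^ p * \<alpha> ^ (k * p) * \<beta> ^ (k * (N - Suc p))
        * ((-1) ^ n / x ^ (N - p)) * ((-1) ^ m / y ^ Suc p))"
    unfolding eq sum_distrib_left by (intro sum.cong) (simp_all add: power_add)
  finally show ?thesis
    by (simp only: x_def y_def flip: power_mult)
qed

text \<open>The relation \<open>\<alpha> * \<beta> = pi ^ 2\<close> makes the denominators of the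
  kernel series proportional to those of \<open>lattice_term\<close>. The term
  \<open>- 1 / (2 * pi * x)\<close> of the kernel sums separately to a multiple of the zeta value at
  \<open>2 * k * (N + 1)\<close>.\<close>

lemma scaled_kernel_series:
  assumes \<alpha>: "\<alpha> > 0" and \<beta>: "\<beta> > 0" and \<alpha>\<beta>: "\<alpha> * \<beta> = pi ^ 2" and k: "k \<ge> 1" and N: "N \<ge> 1"
    and c: "1 < c" "c < 2" and T: "(\<lambda>n. \<Sum>m. lattice_term k N \<alpha> \<beta> n m) sums T"
  shows "(\<lambda>n. (-1) ^ n * scaled_alt_hurwitz_kernel c \<alpha> (real (n + 1)) 1 k / of_nat (n + 1) ^ (2 * k * (N + 1) - 1))
    sums (- alt_hurwitz_zeta (of_nat (2 * k * (N + 1))) 1 / (2 * of_real \<alpha>) + of_real (\<alpha> ^ (k - 1) * T))"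
proof -
  have "(-1) ^ n * scaled_alt_hurwitz_kernel c \<alpha> (real (n + 1)) 1 k / of_nat (n + 1) ^ (2 * k * (N + 1) - 1)
     = - (1 / (2 * of_real \<alpha>)) * ((-1) ^ n / of_real (real n + 1) ^ (2 * k * (N + 1)))
       + of_real (\<alpha> ^ (k - 1) * (\<Sum>m. lattice_term k N \<alpha> \<beta> n m))" for n
  proof -
    define i where "i = real (n + 1)"
    define x where "x = \<alpha> * i / pi"
    have i: "i > 0" and x: "x > 0" using \<alpha> by (auto simp: i_def x_def)
    have pi_pow: "pi ^ (2 * k) = \<alpha> ^ k * \<beta> ^ k"
      by (simp add: power_mult \<alpha>\<beta>[symmetric] power_mult_distrib)
    define d where "d = (\<lambda>m. \<alpha> ^ k * i ^ (2 * k) + \<beta> ^ k * real (m + 1) ^ (2 * k))"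
    have den: "(real m + 1) ^ (2 * k) + x ^ (2 * k) = \<alpha> ^ k / pi ^ (2 * k) * d m" for m
    proof -
      have "pi ^ (2 * k) * x ^ (2 * k) = \<alpha> ^ k * (\<alpha> ^ k * i ^ (2 * k))"
        by (simp add: x_def power_divide power_mult_distrib mult_2 power_add)
      moreover have "pi ^ (2 * k) * (real m + 1) ^ (2 * k) = \<alpha> ^ k * (\<beta> ^ k * real (m + 1) ^ (2 * k))"
        by (simp add: pi_pow add.commute)
      ultimately have "pi ^ (2 * k) * ((real m + 1) ^ (2 * k) + x ^ (2 * k)) = \<alpha> ^ k * d m"
        by (simp add: d_def distrib_left)
      then show ?thesis by (simp add: field_simps)
    qed
    \<comment> \<open>The factor that turns \<open>lattice_term\<close> back into the kernel
      summand: it cancels the sign in \<open>n\<close> and the power \<open>i ^ (2 * k * N)\<close>,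
      and restores the proportionality factor of the denominators.\<close>
    define C where "C = pi ^ (2 * k) / \<alpha> ^ k * i ^ (2 * k * N) * (-1) ^ n"
    have sum_eq: "(\<Sum>m. (-1) ^ m / ((real m + 1) ^ (2 * k) + x ^ (2 * k))) = C * (\<Sum>m. lattice_term k N \<alpha> \<beta> n m)"
    proof -
      have "(-1) ^ m / ((real m + 1) ^ (2 * k) + x ^ (2 * k)) = C * lattice_term k N \<alpha> \<beta> n m" for m
      proof -
        have "(-1) ^ n * (-1) ^ (n + m) = ((-1) ^ m :: real)"
          by (simp add: power_add flip: mult.assoc power_mult_distrib)
        moreover have "C * lattice_term k N \<alpha> \<beta> n m
            = ((-1) ^ n * (-1) ^ (n + m)) * (pi ^ (2 * k) / \<alpha> ^ k * i ^ (2 * k * N)) / (i ^ (2 * k * N) * d m)"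
          by (simp add: lattice_term_def i_def d_def C_def mult_ac)
        ultimately show ?thesis
          unfolding den using i by simp
      qed
      moreover have "\<And>n. summable (lattice_term k N \<alpha> \<beta> n)"
        using lattice_term_series[OF \<alpha> \<beta> k N] by metis
      ultimately show ?thesis by (simp add: suminf_mult)
    qed
    \<comment> \<open>Truncated subtraction is resolved once. The last equation splits the weight
      exponent: \<open>2 * k - 1\<close> is matched by the power of \<open>i\<close> in
      \<open>x ^ (2 * k - 1)\<close>, and \<open>2 * k * N\<close> is what
      \<open>lattice_term\<close> carries.\<close>
    have q: "2 * k * (N + 1) = Suc (2 * k * (N + 1) - 1)" "2 * k = Suc (2 * k - 1)"
      "2 * k * (N + 1) - 1 = 2 * k * N + (2 * k - 1)"
      using k by (auto simp: algebra_simps)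
    have "scaled_alt_hurwitz_kernel c \<alpha> i 1 k = of_real (- 1 / (2 * pi * x) + x ^ (2 * k - 1) / pi * (C * (\<Sum>m. lattice_term k N \<alpha> \<beta> n m)))"
      unfolding scaled_alt_hurwitz_kernel_def x_def[symmetric] alt_hurwitz_kernel_eq[OF c x k zero_less_one] sum_eq ..
    also have "- 1 / (2 * pi * x) = - 1 / (2 * \<alpha> * i)"
      by (simp add: x_def)
    also have "x ^ (2 * k - 1) / pi * (C * (\<Sum>m. lattice_term k N \<alpha> \<beta> n m))
      = (-1) ^ n * i ^ (2 * k * (N + 1) - 1) * (\<alpha> ^ (k - 1) * (\<Sum>m. lattice_term k N \<alpha> \<beta> n m))"
    proof -
      have "x ^ (2 * k - 1) / pi * (pi ^ (2 * k) / \<alpha> ^ k) = \<alpha> ^ (k - 1) * i ^ (2 * k - 1)"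
      proof -
        have "pi ^ (2 * k) = pi * pi ^ (2 * k - 1)" by (subst q(2)) simp
        moreover have "\<alpha> ^ (2 * k - 1) = \<alpha> ^ k * \<alpha> ^ (k - 1)"
          using k by (simp flip: power_add add: mult_2)
        ultimately show ?thesis
          using \<alpha> by (simp add: x_def power_divide power_mult_distrib)
      qed
      then have 1: "x ^ (2 * k - 1) / pi * C = \<alpha> ^ (k - 1) * i ^ (2 * k - 1) * i ^ (2 * k * N) * (-1) ^ n"
        unfolding C_def by (metis mult.assoc)
      have 2: "i ^ (2 * k * (N + 1) - 1) = i ^ (2 * k * N) * i ^ (2 * k - 1)"
        unfolding q(3) by (rule power_add)
      show ?thesis
        unfolding mult.assoc[symmetric, of _ C] 1 2 by (simp only: mult_ac)
    qed
    finally have "(-1) ^ n * scaled_alt_hurwitz_kernel c \<alpha> i 1 k / of_real (i ^ (2 * k * (N + 1) - 1))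
      = of_real ((-1) ^ n * (- 1 / (2 * \<alpha> * i) + (-1) ^ n * i ^ (2 * k * (N + 1) - 1) * (\<alpha> ^ (k - 1) * (\<Sum>m. lattice_term k N \<alpha> \<beta> n m)))
          / i ^ (2 * k * (N + 1) - 1))"
      by simp
    also have "(-1) ^ n * (- 1 / (2 * \<alpha> * i) + (-1) ^ n * i ^ (2 * k * (N + 1) - 1) * (\<alpha> ^ (k - 1) * (\<Sum>m. lattice_term k N \<alpha> \<beta> n m)))
          / i ^ (2 * k * (N + 1) - 1)
      = - (1 / (2 * \<alpha>)) * ((-1) ^ n / i ^ (2 * k * (N + 1))) + \<alpha> ^ (k - 1) * (\<Sum>m. lattice_term k N \<alpha> \<beta> n m)"
    proof -
      define D where "D = i ^ (2 * k * (N + 1) - 1)"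
      have "i ^ (2 * k * (N + 1)) = i * D" unfolding D_def by (subst q(1)) simp
      moreover have "s * (- 1 / (2 * \<alpha> * i) + s * D * Y) / D = - (1 / (2 * \<alpha>)) * (s / (i * D)) + Y"
        if "s * s = 1" for s Y
      proof -
        have "s * (- 1 / (2 * \<alpha> * i) + s * D * Y) = - (s / (2 * \<alpha> * i)) + s * s * (D * Y)"
          by (simp add: algebra_simps)
        then show ?thesis
          using that i by (simp add: D_def add_divide_distrib diff_divide_distrib)
      qed
      moreover have "(-1) ^ n * (-1) ^ n = (1 :: real)"
        by (simp flip: power_mult_distrib)
      ultimately show ?thesis by (simp only: D_def)
    qed
    finally show ?thesis by (simp add: i_def add.commute)
  qed
  moreover have "(\<lambda>n. - (1 / (2 * of_real \<alpha>)) * ((-1) ^ n / of_real (real n + 1) ^ (2 * k * (N + 1)))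
       + of_real (\<alpha> ^ (k - 1) * (\<Sum>m. lattice_term k N \<alpha> \<beta> n m)))
    sums (- (1 / (2 * of_real \<alpha>)) * alt_hurwitz_zeta (of_nat (2 * k * (N + 1))) 1 + of_real (\<alpha> ^ (k - 1) * T))"
    by (intro sums_add sums_mult sums_of_real T alt_hurwitz_zeta_nat_sums) (use k in auto)
  ultimately show ?thesis by simp
qed

text \<open>The pointwise reciprocity is summed over \<open>m\<close> and then over
  \<open>n\<close>, each sum turning one factor into a zeta value. For the second family this order
  is the reverse of the one defining \<open>T'\<close>, so the equality of both iterated sums is
  essential.\<close>

lemma lattice_sum_reciprocity:
  assumes \<alpha>: "\<alpha> > 0" and \<beta>: "\<beta> > 0" and k: "k \<ge> 1" and N: "N \<ge> 1"
    and T: "(\<lambda>n. \<Sum>m. lattice_term k N \<alpha> \<beta> n m) sums T"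
    and T': "(\<lambda>n. \<Sum>m. lattice_term k N \<beta> \<alpha> n m) sums T'"
  shows "complex_of_real (\<beta> ^ (k * N) * T - (-1) ^ N * \<alpha> ^ (k * N) * T')
    = (\<Sum>p<N. (-1) ^ p * of_real (\<alpha> ^ (k * p) * \<beta> ^ (k * (N - Suc p)))
        * alt_hurwitz_zeta (of_nat (2 * k * (N - p))) 1 * alt_hurwitz_zeta (of_nat (2 * k * Suc p)) 1)"
proof -
  define \<eta> where "\<eta> = (\<lambda>q. alt_hurwitz_zeta (of_nat q) 1)"
  define e where "e = (\<lambda>q n. (-1) ^ n / complex_of_real (real n + 1) ^ q)"
  have \<eta>: "e q sums \<eta> q" if "q > 0" for q
    unfolding e_def \<eta>_def using alt_hurwitz_zeta_nat_sums[of 1 q] that by simp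
  define b where "b = (\<lambda>p. complex_of_real ((-1) ^ p * \<alpha> ^ (k * p) * \<beta> ^ (k * (N - Suc p))))"
  have T1: "\<And>n. summable (lattice_term k N \<alpha> \<beta> n)"
    using lattice_term_series[OF \<alpha> \<beta> k N] by metis
  \<comment> \<open>\<open>T'\<close> is given for one order of summation only; \<open>T2\<close>
    comes with both orders and is then identified with \<open>T'\<close>.\<close>
  obtain T2 where T2: "(\<lambda>n. \<Sum>m. lattice_term k N \<beta> \<alpha> n m) sums T2"
    "\<And>m. summable (\<lambda>n. lattice_term k N \<beta> \<alpha> n m)" "(\<lambda>m. \<Sum>n. lattice_term k N \<beta> \<alpha> n m) sums T2"
    using lattice_term_series[OF \<beta> \<alpha> k N] by metis
  have T2_eq: "T2 = T'" using T2(1) T' by (rule sums_unique2)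
  have row: "complex_of_real (\<beta> ^ (k * N) * (\<Sum>m. lattice_term k N \<alpha> \<beta> n m)
        - (-1) ^ N * \<alpha> ^ (k * N) * (\<Sum>m. lattice_term k N \<beta> \<alpha> m n))
      = (\<Sum>p<N. b p * e (2 * k * (N - p)) n * \<eta> (2 * k * Suc p))" for n
  proof (rule sums_unique2)
    show "(\<lambda>m. complex_of_real (\<beta> ^ (k * N) * lattice_term k N \<alpha> \<beta> n m
        - (-1) ^ N * \<alpha> ^ (k * N) * lattice_term k N \<beta> \<alpha> m n))
      sums complex_of_real (\<beta> ^ (k * N) * (\<Sum>m. lattice_term k N \<alpha> \<beta> n m)
        - (-1) ^ N * \<alpha> ^ (k * N) * (\<Sum>m. lattice_term k N \<beta> \<alpha> m n))"
      by (intro sums_of_real sums_diff sums_mult summable_sums T1 T2)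
    have "(\<lambda>m. \<Sum>p<N. b p * e (2 * k * (N - p)) n * e (2 * k * Suc p) m)
      sums (\<Sum>p<N. b p * e (2 * k * (N - p)) n * \<eta> (2 * k * Suc p))"
      using k by (intro sums_sum sums_mult \<eta>) auto
    also have "(\<lambda>m. \<Sum>p<N. b p * e (2 * k * (N - p)) n * e (2 * k * Suc p) m)
      = (\<lambda>m. complex_of_real (\<beta> ^ (k * N) * lattice_term k N \<alpha> \<beta> n m
        - (-1) ^ N * \<alpha> ^ (k * N) * lattice_term k N \<beta> \<alpha> m n))"
      unfolding lattice_term_reciprocity[OF \<alpha> \<beta>] by (simp add: b_def e_def add.commute)
    finally show "(\<lambda>m. complex_of_real (\<beta> ^ (k * N) * lattice_term k N \<alpha> \<beta> n m
        - (-1) ^ N * \<alpha> ^ (k * N) * lattice_term k N \<beta> \<alpha> m n))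
      sums (\<Sum>p<N. b p * e (2 * k * (N - p)) n * \<eta> (2 * k * Suc p))" .
  qed
  have "complex_of_real (\<beta> ^ (k * N) * T - (-1) ^ N * \<alpha> ^ (k * N) * T')
     = (\<Sum>p<N. b p * \<eta> (2 * k * (N - p)) * \<eta> (2 * k * Suc p))"
  proof (rule sums_unique2)
    show "(\<lambda>n. complex_of_real (\<beta> ^ (k * N) * (\<Sum>m. lattice_term k N \<alpha> \<beta> n m)
        - (-1) ^ N * \<alpha> ^ (k * N) * (\<Sum>m. lattice_term k N \<beta> \<alpha> m n)))
      sums complex_of_real (\<beta> ^ (k * N) * T - (-1) ^ N * \<alpha> ^ (k * N) * T')"
      using T2(3) unfolding T2_eq by (intro sums_of_real sums_diff sums_mult T)
    show "(\<lambda>n. complex_of_real (\<beta> ^ (k * N) * (\<Sum>m. lattice_term k N \<alpha> \<beta> n m)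
        - (-1) ^ N * \<alpha> ^ (k * N) * (\<Sum>m. lattice_term k N \<beta> \<alpha> m n)))
      sums (\<Sum>p<N. b p * \<eta> (2 * k * (N - p)) * \<eta> (2 * k * Suc p))"
      unfolding row using k by (intro sums_sum sums_mult sums_mult2 \<eta>) auto
  qed
  then show ?thesis by (simp add: b_def \<eta>_def mult.assoc)
qed

section \<open>Assembly of the transformation formula\<close>

theorem corollary1p23:
  fixes \<alpha> \<beta> c :: real and k N :: nat
  assumes "\<alpha> > 0" and "\<beta> > 0" and "\<alpha> * \<beta> = pi ^ 2"
    and "k \<ge> 1" and "N \<ge> 1"
    and "1 < c" and "c < 2"
  shows
    "summable (\<lambda>n. (-1) ^ n * scaled_alt_hurwitz_kernel c \<alpha> (real (n + 1)) 1 k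
                      / of_nat (n + 1) ^ (2 * k * (N + 1) - 1)) \<and>
     summable (\<lambda>n. (-1) ^ n * scaled_alt_hurwitz_kernel c \<beta> (real (n + 1)) 1 k
                      / of_nat (n + 1) ^ (2 * k * (N + 1) - 1)) \<and>
     complex_of_real \<beta> ^ (k * (N + 1) - 1) *
       (\<Sum>n. (-1) ^ n * scaled_alt_hurwitz_kernel c \<alpha> (real (n + 1)) 1 k
               / of_nat (n + 1) ^ (2 * k * (N + 1) - 1))
     = (-1) ^ N * complex_of_real \<alpha> ^ (k * (N + 1) - 1) *
         (\<Sum>n. (-1) ^ n * scaled_alt_hurwitz_kernel c \<beta> (real (n + 1)) 1 k
                 / of_nat (n + 1) ^ (2 * k * (N + 1) - 1))
       + (\<Sum>p = 0..N + 1. (-1) ^ (p + 1)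
            * alt_hurwitz_zeta (of_nat (2 * k * p)) 1
            * alt_hurwitz_zeta (of_nat (2 * k * (N + 1 - p))) 1
            * complex_of_real \<alpha> powi (int (k * p) - 1)
            * complex_of_real \<beta> powi (int (k * (N + 1 - p)) - 1))"
proof -
  define \<eta> where "\<eta> = (\<lambda>q. alt_hurwitz_zeta (of_nat q) 1)"
  define a b where "a = complex_of_real \<alpha>" and "b = complex_of_real \<beta>"
  define Z where "Z = \<eta> (2 * k * (N + 1))"
  define L where "L = k * (N + 1) - 1"
  note \<alpha> = assms(1) and \<beta> = assms(2) and k = assms(4) and N = assms(5)
  have ab: "a \<noteq> 0" "b \<noteq> 0" using \<alpha> \<beta> by (auto simp: a_def b_def)
  obtain T where T: "(\<lambda>n. \<Sum>m. lattice_term k N \<alpha> \<beta> n m) sums T"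
    using lattice_term_series[OF \<alpha> \<beta> k N] by metis
  obtain T' where T': "(\<lambda>n. \<Sum>m. lattice_term k N \<beta> \<alpha> n m) sums T'"
    using lattice_term_series[OF \<beta> \<alpha> k N] by metis
  have "\<beta> * \<alpha> = pi ^ 2" using assms(3) by (simp add: mult.commute)
  note S = scaled_kernel_series[OF \<alpha> \<beta> assms(3) k N assms(6,7) T]
    and S' = scaled_kernel_series[OF \<beta> \<alpha> this k N assms(6,7) T']
  define t where "t = (\<lambda>p. (-1) ^ (p + 1) * \<eta> (2 * k * p) * \<eta> (2 * k * (N + 1 - p))
            * a powi (int (k * p) - 1) * b powi (int (k * (N + 1 - p)) - 1))"
  \<comment> \<open>This splitting gives
    \<open>b ^ L * a ^ (k - 1) = (a * b) ^ (k - 1) * b ^ (k * N)\<close>, the factor that the finite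
    sum produces below, and likewise with \<open>a\<close> and \<open>b\<close> exchanged.\<close>
  have L: "L = k * N + (k - 1)" using k by (simp add: L_def)
  \<comment> \<open>For \<open>q \<ge> 1\<close> the exponent is a natural number. The exponent
    \<open>- 1\<close> occurs only for \<open>q = 0\<close>, that is, in the two end terms.\<close>
  have powi_minus_1: "z powi (int (k * q) - 1) = z ^ (k * (q - 1)) * z ^ (k - 1)" if "q \<ge> 1" for z :: complex and q
  proof -
    have "int (k * q) - 1 = int (k * (q - 1) + (k - 1))"
      using k that by (cases q) (auto simp: of_nat_diff)
    then show ?thesis by (simp only: power_int_of_nat power_add)
  qed
  have \<eta>_0: "\<eta> 0 = 1 / 2" by (simp add: \<eta>_def alt_hurwitz_zeta_0)
  \<comment> \<open>The end terms contain the zeta value \<open>1 / 2\<close> at 0. They are the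
    contributions of \<open>- 1 / (2 * pi * x)\<close> from the two sides, the one at
    \<open>p = N + 1\<close> with its sign changed by crossing the equation.\<close>
  have t_0: "t 0 = - (b ^ L * Z / (2 * a))"
    using powi_minus_1[of "N + 1" b] by (simp add: t_def \<eta>_0 Z_def L power_add power_int_minus field_simps)
  have t_last: "t (N + 1) = (-1) ^ N * (a ^ L * Z / (2 * b))"
    using powi_minus_1[of "N + 1" a] by (simp add: t_def \<eta>_0 Z_def L power_add power_int_minus field_simps)
  \<comment> \<open>Every middle term has the factor \<open>(a * b) ^ (k - 1)\<close>; the rest is
    the summand of the lattice reciprocity, whose index \<open>p < N\<close> corresponds to
    \<open>Suc p\<close> here.\<close>
  have t_mid: "t (Suc p) = (a * b) ^ (k - 1) * ((-1) ^ p * (a ^ (k * p) * b ^ (k * (N - Suc p)))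
        * \<eta> (2 * k * (N - p)) * \<eta> (2 * k * Suc p))" if "p < N" for p
  proof -
    have "N + 1 - Suc p = N - p" by simp
    moreover have "a powi (int (k * Suc p) - 1) = a ^ (k * p) * a ^ (k - 1)"
      using powi_minus_1[of "Suc p" a] by simp
    moreover have "b powi (int (k * (N - p)) - 1) = b ^ (k * (N - Suc p)) * b ^ (k - 1)"
      using powi_minus_1[of "N - p" b] that by simp
    ultimately show ?thesis
      by (simp only: t_def) (simp add: power_mult_distrib mult_ac)
  qed
  define R where "R = (\<Sum>p = 0..N + 1. t p)"
  have "R = t 0 + (\<Sum>p<N. t (Suc p)) + t (N + 1)"
  proof -
    have "R = t 0 + (\<Sum>p\<le>N. t (Suc p))"
      by (simp only: R_def atLeast0AtMost Suc_eq_plus1[symmetric] sum.atMost_Suc_shift)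
    also have "(\<Sum>p\<le>N. t (Suc p)) = (\<Sum>p<N. t (Suc p)) + t (Suc N)"
      by (simp only: lessThan_Suc_atMost[symmetric] sum.lessThan_Suc)
    finally show ?thesis by simp
  qed
  also have "(\<Sum>p<N. t (Suc p)) = (a * b) ^ (k - 1) * (b ^ (k * N) * of_real T - (-1) ^ N * a ^ (k * N) * of_real T')"
    using lattice_sum_reciprocity[OF \<alpha> \<beta> k N T T']
    by (simp add: t_mid sum_distrib_left \<eta>_def a_def b_def)
  finally have "b ^ L * (- Z / (2 * a) + of_real (\<alpha> ^ (k - 1) * T))
     = (-1) ^ N * a ^ L * (- Z / (2 * b) + of_real (\<beta> ^ (k - 1) * T')) + R"
    by (simp add: t_0 t_last[unfolded Suc_eq_plus1[symmetric]] L power_add power_mult_distrib a_def b_def algebra_simps)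
  then show ?thesis
    using S S' by (simp add: sums_iff L_def Z_def \<eta>_def a_def b_def t_def R_def)
qed

end
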